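(* Let $\alpha\geq 0$, $\gamma>0$, $\delta>0$ and let $\beta$ be a real number satisfying $\beta<0$ or $0<\beta<4\gamma^{1/4}\delta^{3/4}$. Let $\theta\in[0,1]$ and set $q=\frac{4}{\theta}$, $p=\frac{2}{1-\theta}$ (with $q=\infty$ if $\theta=0$ and $p=\infty$ if $\theta=1$). Then there is a constant $C>0$ such that for every $f\in L^{2}(\mathbb{R})$, $$\|S(t)f\|_{L_{t}^{q}L_{x}^{p}}\leq C\|f\|_{L^{2}},\qquad t>0.$$
   Context: The operators $S(t)$ are the solution operators of the linear initial-value problem $(\zeta_t+\alpha\zeta_x-\beta\mathcal{H}\zeta_{xx}-\delta\zeta_{xxx})_x=\gamma\zeta$, $\zeta(x,0)=\zeta_0(x)$, $x\in\mathbb{R}$, where $\mathcal{H}$ is the Hilbert transform, $\mathcal{H}f(x)=\frac{1}{\pi}\,\mathrm{p.v.}\int_{-\infty}^{\infty}\frac{f(y)}{x-y}\,dy$, i.e. $\widehat{\mathcal{H}f}(k)=-i\,\mathrm{sign}(k)\widehat{f}(k)$. Explicitly, $$S(t)f(x)=\frac{1}{2\pi}\int_{-\infty}^{\infty}e^{i(kx-m(k)t)}\widehat{f}(k)\,dk,\qquad m(k)=\frac{\gamma}{k}+\alpha k-\beta k|k|+\delta k^{3}\ (k\neq 0),\quad m(0)=0,$$ with the Fourier transform convention $\widehat{f}(k)=\int_{-\infty}^{\infty}e^{-ikx}f(x)\,dx$; that is, $\widehat{S(t)f}(k)=e^{-im(k)t}\widehat f(k)$. The mixed norm is $\|g\|_{L_t^qL_x^p}=\big\|\,\|g(\cdot,t)\|_{L^p(\mathbb{R})}\big\|_{L^q}$,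 the outer $L^q$ norm being taken in the time variable $t>0$. *)

theory Defs
  imports "HOL-Probability.Essential_Supremum"
begin

text \<open>
  \<open>L\<^sup>p\<close> norms take values in \<^typ>\<open>ennreal\<close>, so that they make sense for every function, and the
  exponent ranges over \<open>(0, \<infinity>]\<close>. Non-measurable functions get norm \<open>\<infinity>\<close> (as with \<^const>\<open>esssup\<close>), so a
  finite bound on a norm includes the assertion that the function is measurable.
\<close>

definition enn_powr :: "ennreal \<Rightarrow> real \<Rightarrow> ennreal" where
  "enn_powr x a = (if x = \<infinity> then \<infinity> else ennreal (enn2real x powr a))" \<comment> \<open>only used for \<open>a > 0\<close>\<close>

definition eLp_norm :: "'a measure \<Rightarrow> ennreal \<Rightarrow> ('a \<Rightarrow> ennreal) \<Rightarrow> ennreal" where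
  "eLp_norm M p h =
     (if h \<notin> borel_measurable M then \<infinity>
      else if p = \<infinity> then esssup M h
      else enn_powr (\<integral>\<^sup>+ x. enn_powr (h x) (enn2real p) \<partial>M) (1 / enn2real p))"

definition Lp_norm :: "ennreal \<Rightarrow> (real \<Rightarrow> complex) \<Rightarrow> ennreal" where
  "Lp_norm p f = eLp_norm lborel p (\<lambda>x. ennreal (norm (f x)))"

definition mixed_norm :: "ennreal \<Rightarrow> ennreal \<Rightarrow> (real \<Rightarrow> real \<Rightarrow> complex) \<Rightarrow> ennreal" where
  "mixed_norm q p u = eLp_norm (restrict_space lborel {0<..}) q (\<lambda>t. Lp_norm p (u t))"

text \<open>Elements of \<open>L\<^sup>2(\<real>)\<close> are represented by Borel functions, without passing to a.e. classes.\<close>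

definition L2 :: "(real \<Rightarrow> complex) set" where
  "L2 = {f \<in> borel_measurable lborel. Lp_norm 2 f < \<infinity>}"

text \<open>
  The Fourier transform on \<open>L\<^sup>2\<close> and its inverse are the \<open>L\<^sup>2\<close> limits of the truncated integrals
  (which converge absolutely for \<open>f\<close> in \<open>L\<^sup>2\<close>). By Plancherel's theorem the limits exist and are
  unique up to null sets, so the choice operator only selects a representative.
\<close>

definition fourier_L2 :: "(real \<Rightarrow> complex) \<Rightarrow> real \<Rightarrow> complex" where
  "fourier_L2 f = (SOME g. g \<in> L2 \<and>
     ((\<lambda>R. Lp_norm 2 (\<lambda>k. g k - (CLINT x:{-R..R}|lborel. exp (- \<i> * k * x) * f x)))
        \<longlongrightarrow> 0) at_top)"

definition inverse_fourier_L2 :: "(real \<Rightarrow> complex) \<Rightarrow> real \<Rightarrow> complex" where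
  "inverse_fourier_L2 g = (SOME h. h \<in> L2 \<and>
     ((\<lambda>R. Lp_norm 2 (\<lambda>x. h x - 1 / (2 * pi) * (CLINT k:{-R..R}|lborel. exp (\<i> * k * x) * g k)))
        \<longlongrightarrow> 0) at_top)"

definition symbol :: "real \<Rightarrow> real \<Rightarrow> real \<Rightarrow> real \<Rightarrow> real \<Rightarrow> real" where
  "symbol \<alpha> \<beta> \<gamma> \<delta> k =
     (if k = 0 then 0 else \<gamma> / k + \<alpha> * k - \<beta> * k * \<bar>k\<bar> + \<delta> * k ^ 3)"

definition solution_op ::
    "real \<Rightarrow> real \<Rightarrow> real \<Rightarrow> real \<Rightarrow> real \<Rightarrow> (real \<Rightarrow> complex) \<Rightarrow> real \<Rightarrow> complex" where
  "solution_op \<alpha> \<beta> \<gamma> \<delta> t f =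
     inverse_fourier_L2 (\<lambda>k. exp (- \<i> * symbol \<alpha> \<beta> \<gamma> \<delta> k * t) * fourier_L2 f k)"

end

theory Submission
  imports Defs "HOL-Probability.Characteristic_Functions"
begin

text \<open>
  The condition on \<open>\<beta>\<close> says exactly that \<open>m''\<close> is bounded below by a positive constant on \<open>k > 0\<close>
  (weighted AM-GM), so van der Corput's lemma bounds the integral of \<open>exp (i (k y - m(k) \<tau>))\<close> over \<open>[-n, n]\<close> by \<open>C |\<tau>| powr (-1/2)\<close>,
  uniformly in \<open>n\<close> and \<open>y\<close>. The endpoint \<open>L\<^sup>4 L\<^sup>\<infinity>\<close> follows by a \<open>T T\<^sup>*\<close> argument: for a measurable
  position \<open>x(t)\<close> at which \<open>|u(t, \<cdot>)|\<close> is nearly maximal, put \<open>N = \<integral> |u(t, x(t))|\<^sup>4 dt\<close>, test against \<open>cnj u |u|\<^sup>2\<close>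
  and apply the Hardy--Littlewood--Sobolev inequality for \<open>|t - s| powr (-1/2)\<close>, which gives
  \<open>N\<^sup>2 \<le> C \<parallel>f\<parallel>\<^sup>2 N powr (3/2)\<close>. The remaining exponents interpolate pointwise in time between this endpoint and
  the bound \<open>\<parallel>S(t)f\<parallel>\<^sub>2 \<le> \<parallel>f\<parallel>\<^sub>2\<close>.
\<close>

section \<open>The \<open>T T\<^sup>*\<close> argument and the Hardy--Littlewood--Sobolev inequality\<close>

text \<open>The dispersive kernel over all frequencies does not converge absolutely, so every
  estimate is made on \<open>{-n..n}\<close> with constants independent of \<open>n\<close>, and
  Fatou's lemma removes the cutoff. The cutoff also makes square integrable data integrable, which
  justifies exchanging integrals and makes the solutions continuous in \<open>x\<close>. Time is cut
  off to \<open>{0..T}\<close> so that \<open>N\<close> is finite before it is divided out.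

  The exponent 4 is dictated by the decay \<open>|t| powr (-1/2)\<close>: convolution with this
  kernel maps \<open>L^(4/3)\<close> to its dual \<open>L^4\<close>. A test function of size
  \<open>|u|^3\<close> has \<open>L^(4/3)\<close> norm \<open>N powr (3/4)\<close>, and its square
  is the factor \<open>N powr (3/2)\<close>.

  A second obstacle is that \<open>solution_op\<close> chooses a representative at each time
  separately, so nothing forces measurability in \<open>(t, x)\<close>. It is compared with explicit
  pointwise limits of truncated transforms. These limits rest on Bessel's inequality with constant
  \<open>2 * pi\<close>, which comes from the same abstract lemma \<open>TT_star_bound\<close> as
  the dispersive estimate, with a Gaussian as frequency measure.\<close>

lemma borel_measurable_cnj [measurable (raw)]:
  "f \<in> borel_measurable M \<Longrightarrow> (\<lambda>x. cnj (f x)) \<in> borel_measurable M"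
  by (rule borel_measurable_continuous_on[OF _ , of cnj]) (auto intro: continuous_intros)

text \<open>For a non-integrable \<open>f\<close> the left side is 0, the default value of the
  Bochner integral, so the bound can be used without checking integrability.\<close>

lemma ennreal_norm_integral_le:
  fixes f :: "'a \<Rightarrow> complex"
  shows "ennreal (norm (integral\<^sup>L M f)) \<le> (\<integral>\<^sup>+x. ennreal (norm (f x)) \<partial>M)"
  by (cases "integrable M f") (simp_all add: integral_norm_bound_ennreal not_integrable_integral_eq)

context pair_sigma_finite
begin

text \<open>Fubini in bilinear form: the operator with kernel \<open>e\<close> is moved from
  \<open>g\<close> to \<open>H\<close>. Since \<open>e\<close> and \<open>H\<close> are bounded and
  \<open>M2\<close> is finite, \<open>B * g t\<close> is an integrable majorant on the
  product.\<close>

lemma integral_swap_bounded_kernel: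
  fixes e :: "'a \<Rightarrow> 'b \<Rightarrow> complex"
  assumes "finite_measure M2"
    and [measurable]: "(\<lambda>(t, k). e t k) \<in> borel_measurable (M1 \<Otimes>\<^sub>M M2)" "H \<in> borel_measurable M2"
    and g: "integrable M1 g"
    and e: "\<And>t k. norm (e t k) \<le> 1" and H: "\<And>k. norm (H k) \<le> B"
  shows "(\<integral>k. (\<integral>t. e t k * g t \<partial>M1) * H k \<partial>M2) = (\<integral>t. g t * (\<integral>k. e t k * H k \<partial>M2) \<partial>M1)"
proof -
  interpret A: finite_measure M2 by fact
  have [measurable]: "g \<in> borel_measurable M1" using g by simp
  have "integrable (M1 \<Otimes>\<^sub>M M2) (\<lambda>(t, k). complex_of_real B * g t)"
    by (rule Fubini_integrable) (use g in auto)
  then have int: "integrable (M1 \<Otimes>\<^sub>M M2) (\<lambda>(t, k). e t k * g t * H k)"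
  proof (rule Bochner_Integration.integrable_bound)
    have "norm (e t k * g t * H k) \<le> norm (complex_of_real B * g t)" for t k
    proof -
      have "norm (e t k * g t * H k) = norm (e t k) * norm (H k) * norm (g t)"
        by (simp add: norm_mult)
      also have "\<dots> \<le> 1 * B * norm (g t)"
        by (intro mult_right_mono mult_mono e H) auto
      also have "\<dots> \<le> norm (complex_of_real B * g t)"
        by (simp add: norm_mult mult_right_mono)
      finally show ?thesis .
    qed
    then show "AE x in M1 \<Otimes>\<^sub>M M2. norm (case x of (t, k) \<Rightarrow> e t k * g t * H k)
        \<le> norm (case x of (t, k) \<Rightarrow> complex_of_real B * g t)"
      by auto
  qed measurable
  have "(\<integral>k. (\<integral>t. e t k * g t \<partial>M1) * H k \<partial>M2) = (\<integral>k. (\<integral>t. e t k * g t * H k \<partial>M1) \<partial>M2)"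
    by simp
  also have "\<dots> = (\<integral>t. (\<integral>k. e t k * g t * H k \<partial>M2) \<partial>M1)"
    using Fubini_integral[OF int] by simp
  also have "\<dots> = (\<integral>t. g t * (\<integral>k. e t k * H k \<partial>M2) \<partial>M1)"
    by (simp flip: integral_mult_right_zero add: algebra_simps)
  finally show ?thesis .
qed

text \<open>Expanding the square and exchanging integrals twice turns the energy of the transform of
  \<open>g\<close> into a quadratic form in \<open>g\<close> whose kernel is that of the composed
  operator; absolute values then go inside. It serves twice: time against truncated frequency, and
  space against Gaussian frequency.\<close>

lemma TT_star_bound:
  fixes e :: "'a \<Rightarrow> 'b \<Rightarrow> complex"
  assumes A: "finite_measure M2"
    and m [measurable]: "(\<lambda>(t, k). e t k) \<in> borel_measurable (M1 \<Otimes>\<^sub>M M2)"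
    and g: "integrable M1 g"
    and e: "\<And>t k. norm (e t k) \<le> 1"
  shows "(\<integral>\<^sup>+k. ennreal ((norm (\<integral>t. e t k * g t \<partial>M1))\<^sup>2) \<partial>M2) \<le>
    (\<integral>\<^sup>+t. \<integral>\<^sup>+s. ennreal (norm (g t) * norm (g s) * norm (\<integral>k. e t k * cnj (e s k) \<partial>M2)) \<partial>M1 \<partial>M1)"
proof -
  interpret A: finite_measure M2 by fact
  have [measurable]: "g \<in> borel_measurable M1" using g by simp
  define G where "G k = (\<integral>t. e t k * g t \<partial>M1)" for k
  define L where "L = (\<integral>t. norm (g t) \<partial>M1)"
  have [measurable]: "G \<in> borel_measurable M2" unfolding G_def by measurable
  have G: "norm (G k) \<le> L" for k
  proof -
    have "norm (G k) \<le> (\<integral>t. norm (e t k * g t) \<partial>M1)"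
      unfolding G_def by (rule integral_norm_bound)
    also have "\<dots> \<le> L"
      unfolding L_def
    proof (rule integral_mono_AE')
      show "AE x in M1. norm (e x k * g x) \<le> norm (g x)"
        using e by (auto simp: norm_mult mult_left_le_one_le)
    qed (use g in auto)
    finally show ?thesis .
  qed
  have Gint: "integrable M2 (\<lambda>k. (norm (G k))\<^sup>2)"
    by (rule A.integrable_const_bound[of _ "L\<^sup>2"]) (auto intro!: power_mono G)
  \<comment> \<open>The swap with \<open>cnj (e t k)\<close> in the role of \<open>H\<close>; it
    reveals the composed kernel. The outer swap below uses \<open>cnj (G k)\<close>, bounded by
    \<open>L\<close>.\<close>
  have inner: "(\<integral>k. e t k * cnj (G k) \<partial>M2)
      = cnj (\<integral>s. g s * (\<integral>k. e s k * cnj (e t k) \<partial>M2) \<partial>M1)" if "t \<in> space M1" for t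
  proof -
    have [measurable]: "(\<lambda>k. e t k) \<in> borel_measurable M2"
      using that by measurable
    have "(\<integral>k. G k * cnj (e t k) \<partial>M2) = (\<integral>s. g s * (\<integral>k. e s k * cnj (e t k) \<partial>M2) \<partial>M1)"
      unfolding G_def using that
      by (intro integral_swap_bounded_kernel[where B=1] A m g e) (auto intro: e)
    moreover have "(\<integral>k. e t k * cnj (G k) \<partial>M2) = cnj (\<integral>k. G k * cnj (e t k) \<partial>M2)"
      by (subst Bochner_Integration.integral_cnj[symmetric]) (simp add: mult.commute)
    ultimately show ?thesis by simp
  qed
  have "(\<integral>\<^sup>+k. ennreal ((norm (G k))\<^sup>2) \<partial>M2) = ennreal (\<integral>k. (norm (G k))\<^sup>2 \<partial>M2)"
    by (rule nn_integral_eq_integral[OF Gint]) auto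
  also have "(\<integral>k. (norm (G k))\<^sup>2 \<partial>M2) = norm (complex_of_real (\<integral>k. (norm (G k))\<^sup>2 \<partial>M2))"
    by simp
  also have "complex_of_real (\<integral>k. (norm (G k))\<^sup>2 \<partial>M2) = (\<integral>k. G k * cnj (G k) \<partial>M2)"
    by (simp only: integral_complex_of_real[symmetric] complex_norm_square)
  also have "\<dots> = (\<integral>t. g t * (\<integral>k. e t k * cnj (G k) \<partial>M2) \<partial>M1)"
    unfolding G_def[of "_"]
    by (intro integral_swap_bounded_kernel[where B=L] A m g e) (auto simp: G simp flip: G_def)
  also have "ennreal (norm \<dots>) \<le> (\<integral>\<^sup>+t. ennreal (norm (g t * (\<integral>k. e t k * cnj (G k) \<partial>M2))) \<partial>M1)"
    by (rule ennreal_norm_integral_le)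
  also have "\<dots> \<le> (\<integral>\<^sup>+t. ennreal (norm (g t)) * (\<integral>\<^sup>+s. ennreal (norm (g s * (\<integral>k. e s k * cnj (e t k) \<partial>M2))) \<partial>M1) \<partial>M1)"
    by (intro nn_integral_mono)
       (auto simp: norm_mult inner ennreal_mult intro!: mult_left_mono order_trans[OF ennreal_norm_integral_le])
  also have "\<dots> = (\<integral>\<^sup>+t. \<integral>\<^sup>+s. ennreal (norm (g t) * norm (g s) * norm (\<integral>k. e t k * cnj (e s k) \<partial>M2)) \<partial>M1 \<partial>M1)"
  proof (intro nn_integral_cong)
    fix t assume "t \<in> space M1"
    then have [measurable]: "e t \<in> borel_measurable M2" by measurable
    have "norm (\<integral>k. e s k * cnj (e t k) \<partial>M2) = norm (\<integral>k. e t k * cnj (e s k) \<partial>M2)" for s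
    proof -
      have "(\<integral>k. e s k * cnj (e t k) \<partial>M2) = cnj (\<integral>k. e t k * cnj (e s k) \<partial>M2)"
        by (subst Bochner_Integration.integral_cnj[symmetric]) (simp add: mult.commute)
      then show ?thesis by simp
    qed
    then show "ennreal (norm (g t)) * (\<integral>\<^sup>+s. ennreal (norm (g s * (\<integral>k. e s k * cnj (e t k) \<partial>M2))) \<partial>M1) =
         (\<integral>\<^sup>+s. ennreal (norm (g t) * norm (g s) * norm (\<integral>k. e t k * cnj (e s k) \<partial>M2)) \<partial>M1)"
      by (subst nn_integral_cmult[symmetric]) (auto simp: norm_mult ennreal_mult mult_ac)
  qed
  finally show ?thesis unfolding G_def .
qed

end

section \<open>Fractional integration with the kernel \<open>|t - s| powr (-1/2)\<close>\<close>

lemma nn_integral_powr_near: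
  assumes "R \<ge> 0"
  shows "(\<integral>\<^sup>+s. ennreal (\<bar>t - s\<bar> powr (-1/2)) * indicator {s. \<bar>t - s\<bar> < R} s \<partial>lborel) \<le> ennreal (4 * sqrt R)"
proof -
  have "((\<lambda>x. x powr (-1/2)) has_integral (R powr (-1/2 + 1) / (-1/2 + 1))) {0..R}"
    by (rule has_integral_powr_from_0) (use assms in auto)
  then have "((\<lambda>x. x powr (-1/2)) has_integral (2 * sqrt R)) {0..R}"
    using assms by (simp add: powr_half_sqrt mult.commute)
  then have half: "(\<integral>\<^sup>+x. ennreal (x powr (-1/2)) * indicator {0..R} x \<partial>lborel) = ennreal (2 * sqrt R)"
    by (intro nn_integral_has_integral_lebesgue') auto
  have "(\<integral>\<^sup>+s. ennreal (\<bar>t - s\<bar> powr (-1/2)) * indicator {s. \<bar>t - s\<bar> < R} s \<partial>lborel) \<le>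
    (\<integral>\<^sup>+s. ennreal ((s - t) powr (-1/2)) * indicator {0..R} (s - t) + ennreal ((t - s) powr (-1/2)) * indicator {0..R} (t - s) \<partial>lborel)"
    by (rule nn_integral_mono) (auto split: split_indicator simp: abs_if)
  also have "\<dots> = (\<integral>\<^sup>+s. ennreal ((s - t) powr (-1/2)) * indicator {0..R} (s - t) \<partial>lborel)
      + (\<integral>\<^sup>+s. ennreal ((t - s) powr (-1/2)) * indicator {0..R} (t - s) \<partial>lborel)"
    by (rule nn_integral_add) auto
  also have "\<dots> = ennreal (2 * sqrt R) + ennreal (2 * sqrt R)"
    using half nn_integral_real_affine[of "\<lambda>x. ennreal (x powr (-1/2)) * indicator {0..R} x" 1 "-t"]
     nn_integral_real_affine[of "\<lambda>x. ennreal (x powr (-1/2)) * indicator {0..R} x" "-1" "t"]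
    by simp
  finally show ?thesis using assms by (simp flip: ennreal_plus)
qed

text \<open>The integrand is the fourth power of the kernel \<open>|t - s| powr (-1/2)\<close>. The
  kernel itself is not integrable at infinity, but its fourth power is, which suits Young's
  inequality with exponents 4/3 and 4.\<close>

lemma nn_integral_inverse_square_far:
  assumes "R > 0"
  shows "(\<integral>\<^sup>+s. ennreal (1 / \<bar>t - s\<bar>\<^sup>2) * indicator {s. R \<le> \<bar>t - s\<bar>} s \<partial>lborel) \<le> ennreal (2 / R)"
proof -
  have "((\<lambda>x. 1 / x ^ 2) has_integral (1 / (real (2 - 1) * R ^ (2 - 1)))) {R..}"
    by (rule has_integral_inverse_power_to_inf) (use assms in auto)
  then have "((\<lambda>x. 1 / x ^ 2) has_integral (1 / R)) {R..}"
    by simp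
  then have half: "(\<integral>\<^sup>+x. ennreal (1 / x ^ 2) * indicator {R..} x \<partial>lborel) = ennreal (1 / R)"
    by (intro nn_integral_has_integral_lebesgue') auto
  have "(\<integral>\<^sup>+s. ennreal (1 / \<bar>t - s\<bar>\<^sup>2) * indicator {s. R \<le> \<bar>t - s\<bar>} s \<partial>lborel) \<le>
    (\<integral>\<^sup>+s. ennreal (1 / (s - t)\<^sup>2) * indicator {R..} (s - t) + ennreal (1 / (t - s)\<^sup>2) * indicator {R..} (t - s) \<partial>lborel)"
    by (rule nn_integral_mono) (auto split: split_indicator simp: abs_if)
  also have "\<dots> = (\<integral>\<^sup>+s. ennreal (1 / (s - t)\<^sup>2) * indicator {R..} (s - t) \<partial>lborel)
      + (\<integral>\<^sup>+s. ennreal (1 / (t - s)\<^sup>2) * indicator {R..} (t - s) \<partial>lborel)"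
    by (rule nn_integral_add) auto
  also have "\<dots> = ennreal (1 / R) + ennreal (1 / R)"
    using half nn_integral_real_affine[of "\<lambda>x. ennreal (1 / x ^ 2) * indicator {R..} x" 1 "-t"]
     nn_integral_real_affine[of "\<lambda>x. ennreal (1 / x ^ 2) * indicator {R..} x" "-1" "t"]
    by simp
  finally show ?thesis using assms by (simp flip: ennreal_plus)
qed

text \<open>Young's inequality with exponents 4/3 and 4, up to constants: according to which of
  \<open>y\<close> and \<open>l * w\<close> is larger, one of the two terms on the right suffices
  alone.\<close>

lemma cube_times_le_weighted_sum:
  fixes w y l :: real
  assumes "w \<ge> 0" "y \<ge> 0" "l > 0"
  shows "w ^ 3 * y \<le> l * w ^ 4 + y ^ 4 / l ^ 3"
proof (cases "y \<le> l * w")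
  case True
  have "w ^ 3 * y \<le> w ^ 3 * (l * w)" using True assms by (intro mult_left_mono) auto
  also have "\<dots> = l * w ^ 4" by algebra
  also have "\<dots> \<le> l * w ^ 4 + y ^ 4 / l ^ 3" using assms by simp
  finally show ?thesis .
next
  case False
  then have "w \<le> y / l" using assms by (simp add: field_simps)
  then have "w ^ 3 * y \<le> (y / l) ^ 3 * y" using assms by (intro mult_right_mono power_mono) auto
  also have "\<dots> = y ^ 4 / l ^ 3" using assms by (simp add: field_simps power_def numeral_eq_Suc)
  also have "\<dots> \<le> l * w ^ 4 + y ^ 4 / l ^ 3" using assms by simp
  finally show ?thesis .
qed

text \<open>
  Only the pairs with \<open>w s \<le> w t\<close> are needed, by symmetry. This makes the inner integral elementary: bound
  \<open>w s\<close> by \<open>w t\<close> near the diagonal and use \<open>cube_times_le_weighted_sum\<close> away from it; the radius \<open>R\<close> and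
  the weight \<open>l\<close> balance the three resulting terms.
\<close>

lemma hardy_littlewood_sobolev_half:
  fixes w :: "real \<Rightarrow> real"
  assumes [measurable]: "w \<in> borel_measurable borel" and w: "\<And>s. w s \<ge> 0"
    and N: "(\<integral>\<^sup>+s. ennreal (w s ^ 4) \<partial>lborel) = ennreal N" "N > 0"
  shows "(\<integral>\<^sup>+s. ennreal (w t ^ 3 * w s ^ 3 * \<bar>t - s\<bar> powr (-1/2)) * indicator {s. w s \<le> w t} s \<partial>lborel)
    \<le> ennreal (7 * sqrt N) * ennreal (w t ^ 4)"
proof (cases "w t = 0")
  case True
  then show ?thesis by simp
next
  case False
  define a where "a = w t"
  have a: "a > 0" using False w[of t] by (simp add: a_def)
  \<comment> \<open>These values make \<open>a ^ 3 * sqrt R\<close>, \<open>l * N\<close> and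
    \<open>1 / (l ^ 3 * R)\<close> all equal to \<open>a * sqrt N\<close>. They occur with
    coefficients 4, 1 and 2, which gives the constant 7.\<close>
  define R where "R = N / a ^ 4"
  define l where "l = a / sqrt N"
  have R: "R > 0" and l: "l > 0" using a N by (simp_all add: R_def l_def)
  have sR: "a ^ 3 * sqrt R = a * sqrt N"
  proof -
    have "sqrt R = sqrt N / a\<^sup>2"
      unfolding R_def real_sqrt_divide using a
      by (metis (no_types, lifting) numeral_Bit0 order_less_imp_le power2_eq_square power_add real_sqrt_unique zero_le_power mult_2 )
    then show ?thesis using a by (simp add: field_simps power_def numeral_eq_Suc)
  qed
  have lN: "l * N = a * sqrt N" unfolding l_def using N(2)
    by (simp add: real_div_sqrt field_simps)
  have lR: "1 / l ^ 3 * (2 / R) = 2 * (a * sqrt N)"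
  proof -
    have "sqrt N ^ 3 = N * sqrt N" using N(2) by (simp add: power3_eq_cube)
    then show ?thesis unfolding l_def R_def using a N(2)
      by (simp add: field_simps power_def numeral_eq_Suc)
  qed
  have pw: "ennreal (a ^ 3 * w s ^ 3 * \<bar>t - s\<bar> powr (-1/2)) * indicator {s. w s \<le> a} s \<le>
     ennreal (a ^ 3) * (ennreal (a ^ 3) * (ennreal (\<bar>t - s\<bar> powr (-1/2)) * indicator {s. \<bar>t - s\<bar> < R} s)
      + (ennreal l * ennreal (w s ^ 4) + ennreal (1 / l ^ 3) * (ennreal (1 / \<bar>t - s\<bar>\<^sup>2) * indicator {s. R \<le> \<bar>t - s\<bar>} s)))"
    (is "?L \<le> ?R") for s
  proof (cases "w s \<le> a")
    case ws: True
    show ?thesis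
    proof (cases "\<bar>t - s\<bar> < R")
      case True
      have "a ^ 3 * w s ^ 3 * \<bar>t - s\<bar> powr (-1/2) \<le> a ^ 3 * (a ^ 3 * \<bar>t - s\<bar> powr (-1/2))"
        unfolding mult.assoc using a ws w[of s] by (intro mult_left_mono mult_right_mono power_mono) auto
      then have "?L \<le> ennreal (a ^ 3) * (ennreal (a ^ 3) * ennreal (\<bar>t - s\<bar> powr (-1/2)))"
        using ws a by (simp flip: ennreal_mult)
      also have "\<dots> \<le> ?R" using True by (intro mult_left_mono) auto
      finally show ?thesis .
    next
      case False
      have *: "(\<bar>t - s\<bar> powr (-1/2)) ^ 4 = 1 / \<bar>t - s\<bar>\<^sup>2"
        using False R by (simp add: powr_power powr_minus powr_numeral field_simps)
      have "w s ^ 3 * \<bar>t - s\<bar> powr (-1/2) \<le> l * w s ^ 4 + (1 / l ^ 3) * (1 / \<bar>t - s\<bar>\<^sup>2)"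
        using cube_times_le_weighted_sum[of "w s" "\<bar>t - s\<bar> powr (-1/2)" l] w[of s] l unfolding * by (simp add: mult.commute)
      then have "a ^ 3 * (w s ^ 3 * \<bar>t - s\<bar> powr (-1/2)) \<le> a ^ 3 * (l * w s ^ 4 + (1 / l ^ 3) * (1 / \<bar>t - s\<bar>\<^sup>2))"
        using a by (intro mult_left_mono) auto
      then have "ennreal (a ^ 3 * (w s ^ 3 * \<bar>t - s\<bar> powr (-1/2))) \<le> ennreal (a ^ 3 * (l * w s ^ 4 + (1 / l ^ 3) * (1 / \<bar>t - s\<bar>\<^sup>2)))"
        by (rule ennreal_leI)
      also have "\<dots> = ennreal (a ^ 3) * (ennreal l * ennreal (w s ^ 4) + ennreal (1 / l ^ 3) * ennreal (1 / \<bar>t - s\<bar>\<^sup>2))"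
        using a l w[of s] by (simp flip: ennreal_mult ennreal_plus del: power_abs)
      finally show ?thesis using False ws by (simp add: mult_ac)
    qed
  qed (auto)
  have "(\<integral>\<^sup>+s. ennreal (a ^ 3 * w s ^ 3 * \<bar>t - s\<bar> powr (-1/2)) * indicator {s. w s \<le> a} s \<partial>lborel)
    \<le> (\<integral>\<^sup>+s. ennreal (a ^ 3) * (ennreal (a ^ 3) * (ennreal (\<bar>t - s\<bar> powr (-1/2)) * indicator {s. \<bar>t - s\<bar> < R} s)
      + (ennreal l * ennreal (w s ^ 4) + ennreal (1 / l ^ 3) * (ennreal (1 / \<bar>t - s\<bar>\<^sup>2) * indicator {s. R \<le> \<bar>t - s\<bar>} s))) \<partial>lborel)"
    by (intro nn_integral_mono pw)
  also have "\<dots> = ennreal (a ^ 3) * (ennreal (a ^ 3) * (\<integral>\<^sup>+s. ennreal (\<bar>t - s\<bar> powr (-1/2)) * indicator {s. \<bar>t - s\<bar> < R} s \<partial>lborel)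
      + (ennreal l * (\<integral>\<^sup>+s. ennreal (w s ^ 4) \<partial>lborel)
      + ennreal (1 / l ^ 3) * (\<integral>\<^sup>+s. ennreal (1 / \<bar>t - s\<bar>\<^sup>2) * indicator {s. R \<le> \<bar>t - s\<bar>} s \<partial>lborel)))"
    by (simp add: nn_integral_cmult nn_integral_add del: power_abs power2_abs)
  also have "\<dots> \<le> ennreal (a ^ 3) * (ennreal (a ^ 3) * ennreal (4 * sqrt R)
      + (ennreal l * ennreal N + ennreal (1 / l ^ 3) * ennreal (2 / R)))"
    using R N by (intro mult_left_mono add_mono nn_integral_powr_near nn_integral_inverse_square_far) auto
  also have "\<dots> = ennreal (a ^ 3 * (4 * (a ^ 3 * sqrt R) + (l * N + 1 / l ^ 3 * (2 / R))))"
    using a l R N by (simp flip: ennreal_mult ennreal_plus add: mult_ac)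
  also have "a ^ 3 * (4 * (a ^ 3 * sqrt R) + (l * N + 1 / l ^ 3 * (2 / R))) = 7 * sqrt N * a ^ 4"
    unfolding sR lN lR by algebra
  finally show ?thesis using a N unfolding a_def by (simp add: ennreal_mult)
qed

text \<open>The right side is 14 times the squared \<open>L^(4/3)\<close> norm of
  \<open>w ^ 3\<close>, so this is the usual inequality written for a density that is already a
  cube. The constant is twice 7, one contribution for each order of \<open>w t\<close> and
  \<open>w s\<close>.\<close>

lemma hardy_littlewood_sobolev:
  fixes w :: "real \<Rightarrow> real"
  assumes [measurable]: "w \<in> borel_measurable borel" and w: "\<And>s. w s \<ge> 0"
    and N: "(\<integral>\<^sup>+s. ennreal (w s ^ 4) \<partial>lborel) = ennreal N" "N > 0"
  shows "(\<integral>\<^sup>+t. \<integral>\<^sup>+s. ennreal (w t ^ 3 * w s ^ 3 * \<bar>t - s\<bar> powr (-1/2)) \<partial>lborel \<partial>lborel)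
    \<le> ennreal (14 * sqrt N * N)"
proof -
  define P where "P t s = ennreal (w t ^ 3 * w s ^ 3 * \<bar>t - s\<bar> powr (-1/2)) * indicator {s. w s \<le> w t} s" for t s
  have [measurable]: "(\<lambda>(t, s). P t s) \<in> borel_measurable (borel \<Otimes>\<^sub>M borel)"
    unfolding P_def by measurable
  have "(\<integral>\<^sup>+t. \<integral>\<^sup>+s. ennreal (w t ^ 3 * w s ^ 3 * \<bar>t - s\<bar> powr (-1/2)) \<partial>lborel \<partial>lborel)
      \<le> (\<integral>\<^sup>+t. \<integral>\<^sup>+s. P t s + P s t \<partial>lborel \<partial>lborel)"
    unfolding P_def
    by (intro nn_integral_mono) (auto split: split_indicator simp: abs_minus_commute mult_ac)
  also have "\<dots> = (\<integral>\<^sup>+t. \<integral>\<^sup>+s. P t s \<partial>lborel \<partial>lborel) + (\<integral>\<^sup>+t. \<integral>\<^sup>+s. P s t \<partial>lborel \<partial>lborel)"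
    by (simp add: nn_integral_add)
  also have "(\<integral>\<^sup>+t. \<integral>\<^sup>+s. P s t \<partial>lborel \<partial>lborel) = (\<integral>\<^sup>+t. \<integral>\<^sup>+s. P t s \<partial>lborel \<partial>lborel)"
    by (rule lborel_pair.Fubini') simp
  also have "(\<integral>\<^sup>+t. \<integral>\<^sup>+s. P t s \<partial>lborel \<partial>lborel) \<le> (\<integral>\<^sup>+t. ennreal (7 * sqrt N) * ennreal (w t ^ 4) \<partial>lborel)"
    unfolding P_def by (intro nn_integral_mono hardy_littlewood_sobolev_half assms)
  also have "\<dots> = ennreal (7 * sqrt N) * ennreal N"
    by (simp add: nn_integral_cmult N)
  finally show ?thesis using N by (simp flip: ennreal_mult ennreal_plus add: add_mono mult_ac)
qed

section \<open>Van der Corput estimates\<close>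

text \<open>Integration by parts against \<open>p\<close>. The two boundary terms cost
  \<open>1 / \<mu>\<close> each. As \<open>p\<close> is increasing, the remainder is dominated by
  the exact derivative of \<open>- 1 / p\<close> and costs a third \<open>1 / \<mu>\<close>; neither
  the size of \<open>r\<close> nor the length of the interval enters.\<close>

lemma van_der_Corput_first:
  fixes \<phi> p r :: "real \<Rightarrow> real"
  assumes ab: "a \<le> b" and mu: "\<mu> > 0" "\<mu> \<le> p a"
    and d1: "\<And>x. x \<in> {a..b} \<Longrightarrow> (\<phi> has_real_derivative p x) (at x)"
    and d2: "\<And>x. x \<in> {a..b} \<Longrightarrow> (p has_real_derivative r x) (at x)"
    and r: "continuous_on {a..b} r" "\<And>x. x \<in> {a..b} \<Longrightarrow> 0 \<le> r x"
  shows "norm (integral {a..b} (\<lambda>x. iexp (\<phi> x))) \<le> 3 / \<mu>"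
proof -
  have pmono: "p a \<le> p x" if "x \<in> {a..b}" for x
    by (rule DERIV_nonneg_imp_nondecreasing[of a x p]) (use that r d2 in force)+
  have p: "\<mu> \<le> p x" "p x \<noteq> 0" if "x \<in> {a..b}" for x
    using pmono[OF that] mu by auto
  have c\<phi>: "continuous_on {a..b} \<phi>"
    by (rule DERIV_continuous_on[OF has_field_derivative_at_within[OF d1]])
  have cp: "continuous_on {a..b} p"
    by (rule DERIV_continuous_on[OF has_field_derivative_at_within[OF d2]])
  \<comment> \<open>\<open>F\<close> is \<open>iexp \<phi>\<close> divided by
    \<open>\<i> * p\<close>, and \<open>E\<close> is the error in
    \<open>F' = iexp \<phi> + E\<close>.\<close>
  define F where "F x = iexp (\<phi> x) * (- \<i> * complex_of_real (1 / p x))" for x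
  define E where "E x = \<i> * iexp (\<phi> x) * complex_of_real (r x / (p x)\<^sup>2)" for x
  have FE: "((\<lambda>x. iexp (\<phi> x) + E x) has_integral (F b - F a)) {a..b}"
  proof (rule fundamental_theorem_of_calculus[OF ab])
    fix x assume x: "x \<in> {a..b}"
    have A: "((\<lambda>x. iexp (\<phi> x)) has_vector_derivative (p x *\<^sub>R (\<i> * iexp (\<phi> x)))) (at x)"
      using vector_diff_chain_at[OF d1[OF x, unfolded has_real_derivative_iff_has_vector_derivative]
         has_vector_derivative_iexp]
      by (simp add: o_def)
    have B: "((\<lambda>x. - \<i> * complex_of_real (1 / p x)) has_vector_derivative (- \<i> * complex_of_real (- r x / (p x)\<^sup>2))) (at x)"
    proof -
      have "((\<lambda>x. 1 / p x) has_real_derivative (- r x / (p x)\<^sup>2)) (at x)"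
        by (rule derivative_eq_intros d2[OF x] refl p[OF x])+ (simp add: power2_eq_square)
      then show ?thesis
        by (intro has_vector_derivative_mult_right has_vector_derivative_of_real)
           (simp add: has_real_derivative_iff_has_vector_derivative)
    qed
    have "(F has_vector_derivative (iexp (\<phi> x) * (- \<i> * complex_of_real (- r x / (p x)\<^sup>2))
        + p x *\<^sub>R (\<i> * iexp (\<phi> x)) * (- \<i> * complex_of_real (1 / p x)))) (at x)"
      unfolding F_def by (rule has_vector_derivative_mult[OF A B])
    also have "iexp (\<phi> x) * (- \<i> * complex_of_real (- r x / (p x)\<^sup>2))
        + p x *\<^sub>R (\<i> * iexp (\<phi> x)) * (- \<i> * complex_of_real (1 / p x)) = iexp (\<phi> x) + E x"
      using p[OF x] by (simp add: E_def scaleR_conv_of_real field_simps)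
    finally show "(F has_vector_derivative iexp (\<phi> x) + E x) (at x within {a..b})"
      by (rule has_vector_derivative_at_within)
  qed
  have EE: "(E has_integral integral {a..b} E) {a..b}"
    unfolding E_def using p
    by (intro integrable_integral integrable_continuous_real continuous_intros c\<phi> cp r) auto
  have "((\<lambda>x. iexp (\<phi> x)) has_integral (F b - F a - integral {a..b} E)) {a..b}"
    using has_integral_diff[OF FE EE] by simp
  then have eq: "integral {a..b} (\<lambda>x. iexp (\<phi> x)) = F b - F a - integral {a..b} E"
    by (rule integral_unique)
  have "((\<lambda>x. r x / (p x)\<^sup>2) has_integral (- (1 / p b) - (- (1 / p a)))) {a..b}"
  proof (rule fundamental_theorem_of_calculus[OF ab])
    fix x assume x: "x \<in> {a..b}"
    have "((\<lambda>x. - (1 / p x)) has_real_derivative (r x / (p x)\<^sup>2)) (at x)"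
      by (rule derivative_eq_intros d2[OF x] refl p[OF x])+ (simp add: power2_eq_square)
    then show "((\<lambda>x. - (1 / p x)) has_vector_derivative (r x / (p x)\<^sup>2)) (at x within {a..b})"
      by (simp add: has_real_derivative_iff_has_vector_derivative has_vector_derivative_at_within)
  qed
  then have ri: "(\<lambda>x. r x / (p x)\<^sup>2) integrable_on {a..b}" "integral {a..b} (\<lambda>x. r x / (p x)\<^sup>2) = 1 / p a - 1 / p b"
    by (auto simp: has_integral_iff)
  have "norm (integral {a..b} E) \<le> integral {a..b} (\<lambda>x. r x / (p x)\<^sup>2)"
  proof (rule integral_norm_bound_integral[OF _ ri(1)])
    show "E integrable_on {a..b}"
      unfolding E_def using p
      by (intro integrable_continuous_real continuous_intros c\<phi> cp r) auto
    show "norm (E x) \<le> r x / (p x)\<^sup>2" if "x \<in> {a..b}" for x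
      using r(2)[OF that] by (simp add: E_def norm_mult norm_divide norm_power)
  qed
  also have "\<dots> \<le> 1 / \<mu>"
    using ri(2) p(1)[of a] p(1)[of b] mu ab
    by (smt (verit) atLeastAtMost_iff divide_nonneg_nonneg frac_le)
  finally have E: "norm (integral {a..b} E) \<le> 1 / \<mu>" .
  have F: "norm (F x) \<le> 1 / \<mu>" if "x \<in> {a..b}" for x
    using p(1)[OF that] mu by (simp add: F_def norm_mult norm_divide frac_le)
  have "norm (F b - F a - integral {a..b} E) \<le> norm (F b) + norm (F a) + norm (integral {a..b} E)"
    by (smt (verit) norm_triangle_ineq4)
  then show ?thesis
    unfolding eq using F[of a] F[of b] E ab by auto
qed

text \<open>\<open>p\<close> starts nonnegative and grows at rate at least \<open>\<kappa>\<close>,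
  so it exceeds \<open>\<kappa> * d\<close> beyond an initial piece of length \<open>d\<close>.
  Taking \<open>d = 1 / sqrt \<kappa>\<close> balances the trivial bound \<open>d\<close> against
  \<open>3 / (\<kappa> * d)\<close>; the sum gives the 4.\<close>

lemma van_der_Corput_right:
  fixes \<phi> p r :: "real \<Rightarrow> real"
  assumes ab: "a \<le> b" and lam: "\<kappa> > 0" and pa: "0 \<le> p a"
    and d1: "\<And>x. x \<in> {a..b} \<Longrightarrow> (\<phi> has_real_derivative p x) (at x)"
    and d2: "\<And>x. x \<in> {a..b} \<Longrightarrow> (p has_real_derivative r x) (at x)"
    and r: "continuous_on {a..b} r" "\<And>x. x \<in> {a..b} \<Longrightarrow> \<kappa> \<le> r x"
  shows "norm (integral {a..b} (\<lambda>x. iexp (\<phi> x))) \<le> 4 / sqrt \<kappa>"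
proof -
  define d where "d = 1 / sqrt \<kappa>"
  have d: "d > 0" "\<kappa> * d = sqrt \<kappa>" using lam by (simp_all add: d_def real_div_sqrt)
  have c\<phi>: "continuous_on {a..b} \<phi>"
    by (rule DERIV_continuous_on[OF has_field_derivative_at_within[OF d1]])
  have ci: "continuous_on {a..b} (\<lambda>x. iexp (\<phi> x))" by (intro continuous_intros c\<phi>)
  have short: "norm (integral {a..c} (\<lambda>x. iexp (\<phi> x))) \<le> c - a" if "a \<le> c" "c \<le> b" for c
    using integral_bound[OF that(1), of "\<lambda>x. iexp (\<phi> x)" 1] continuous_on_subset[OF ci, of "{a..c}"] that
    by auto
  show ?thesis
  proof (cases "b \<le> a + d")
    case True
    then have "norm (integral {a..b} (\<lambda>x. iexp (\<phi> x))) \<le> d" using short[of b] ab by simp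
    also have "\<dots> \<le> 4 / sqrt \<kappa>" using lam by (simp add: d_def divide_right_mono)
    finally show ?thesis .
  next
    case False
    have "\<exists>z>a. z < a + d \<and> p (a + d) - p a = (a + d - a) * r z"
      by (rule MVT2) (use d False d2 in auto)
    then obtain z where z: "z > a" "z < a + d" "p (a + d) - p a = d * r z" by auto
    have "d * \<kappa> \<le> d * r z" using r(2)[of z] z d False by (intro mult_left_mono) auto
    then have "sqrt \<kappa> \<le> p (a + d)" using z(3) pa d by (simp add: mult.commute)
    then have "norm (integral {a + d..b} (\<lambda>x. iexp (\<phi> x))) \<le> 3 / sqrt \<kappa>"
      using lam False d r
      by (intro van_der_Corput_first[where p=p and r=r] d1 d2 continuous_on_subset[OF r(1)])
         (auto intro: order_trans[of 0 \<kappa>])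
    moreover have "norm (integral {a..a + d} (\<lambda>x. iexp (\<phi> x))) \<le> 1 / sqrt \<kappa>"
      using short[of "a + d"] False d(1) by (simp add: d_def)
    moreover have "integral {a..b} (\<lambda>x. iexp (\<phi> x)) =
        integral {a..a + d} (\<lambda>x. iexp (\<phi> x)) + integral {a + d..b} (\<lambda>x. iexp (\<phi> x))"
      using False d(1) by (intro Henstock_Kurzweil_Integration.integral_combine[symmetric] integrable_continuous_real ci) auto
    ultimately show ?thesis
      using norm_triangle_ineq[of "integral {a..a + d} (\<lambda>x. iexp (\<phi> x))" "integral {a + d..b} (\<lambda>x. iexp (\<phi> x))"]
      by simp
  qed
qed

text \<open>Reflection at the origin keeps the second derivative of the phase and reverses the sign
  of the first, which reduces the claim to the previous case.\<close>

lemma van_der_Corput_left: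
  fixes \<phi> p r :: "real \<Rightarrow> real"
  assumes ab: "a \<le> b" and lam: "\<kappa> > 0" and pb: "p b \<le> 0"
    and d1: "\<And>x. x \<in> {a..b} \<Longrightarrow> (\<phi> has_real_derivative p x) (at x)"
    and d2: "\<And>x. x \<in> {a..b} \<Longrightarrow> (p has_real_derivative r x) (at x)"
    and r: "continuous_on {a..b} r" "\<And>x. x \<in> {a..b} \<Longrightarrow> \<kappa> \<le> r x"
  shows "norm (integral {a..b} (\<lambda>x. iexp (\<phi> x))) \<le> 4 / sqrt \<kappa>"
proof -
  have "norm (integral {-b..-a} (\<lambda>x. iexp (\<phi> (- x)))) \<le> 4 / sqrt \<kappa>"
  proof (rule van_der_Corput_right[where p="\<lambda>x. - p (- x)" and r="\<lambda>x. r (- x)"])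
    fix x assume "x \<in> {-b..-a}"
    then have x: "- x \<in> {a..b}" by auto
    show "((\<lambda>x. \<phi> (- x)) has_real_derivative - p (- x)) (at x)"
      using DERIV_mirror[THEN iffD1, OF d1[OF x]] .
    show "((\<lambda>x. - p (- x)) has_real_derivative r (- x)) (at x)"
      using DERIV_minus[OF DERIV_mirror[THEN iffD1, OF d2[OF x]]] by simp
    show "\<kappa> \<le> r (- x)" using r(2)[OF x] .
  next
    show "continuous_on {-b..-a} (\<lambda>x. r (- x))"
      by (rule continuous_on_compose2[OF r(1)]) (auto intro!: continuous_intros)
  qed (use assms in auto)
  then show ?thesis
    by (simp only: Henstock_Kurzweil_Integration.integral_reflect_real[of b a "\<lambda>x. iexp (\<phi> x)"])
qed

text \<open>\<open>p\<close> is increasing, so it changes sign at most once; a zero splits the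
  interval into two pieces that cost \<open>4 / sqrt \<kappa>\<close> each. Only the lower bound on
  the second derivative enters the constant: affine terms of the phase and the length of the
  interval do not.\<close>

lemma van_der_Corput_second:
  fixes \<phi> p r :: "real \<Rightarrow> real"
  assumes ab: "a \<le> b" and lam: "\<kappa> > 0"
    and d1: "\<And>x. x \<in> {a..b} \<Longrightarrow> (\<phi> has_real_derivative p x) (at x)"
    and d2: "\<And>x. x \<in> {a..b} \<Longrightarrow> (p has_real_derivative r x) (at x)"
    and r: "continuous_on {a..b} r" "\<And>x. x \<in> {a..b} \<Longrightarrow> \<kappa> \<le> r x"
  shows "norm (integral {a..b} (\<lambda>x. iexp (\<phi> x))) \<le> 8 / sqrt \<kappa>"
proof -
  have le: "4 / sqrt \<kappa> \<le> 8 / sqrt \<kappa>" using lam by (simp add: divide_right_mono)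
  consider "0 \<le> p a" | "p b \<le> 0" | "p a < 0" "0 < p b" by linarith
  then show ?thesis
  proof cases
    case 1
    show ?thesis
      by (rule order_trans[OF van_der_Corput_right[where p=p and r=r] le]) (use 1 assms in auto)
  next
    case 2
    show ?thesis
      by (rule order_trans[OF van_der_Corput_left[where p=p and r=r] le]) (use 2 assms in auto)
  next
    case 3
    have "continuous_on {a..b} p"
      by (rule DERIV_continuous_on[OF has_field_derivative_at_within[OF d2]])
    then obtain c where c: "a \<le> c" "c \<le> b" "p c = 0"
      using IVT'[of p a 0 b] 3 ab by auto
    have L: "norm (integral {a..c} (\<lambda>x. iexp (\<phi> x))) \<le> 4 / sqrt \<kappa>"
      by (rule van_der_Corput_left[where p=p and r=r]) (use c assms in \<open>auto intro: continuous_on_subset\<close>)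
    have R: "norm (integral {c..b} (\<lambda>x. iexp (\<phi> x))) \<le> 4 / sqrt \<kappa>"
      by (rule van_der_Corput_right[where p=p and r=r]) (use c assms in \<open>auto intro: continuous_on_subset\<close>)
    have "continuous_on {a..b} \<phi>"
      by (rule DERIV_continuous_on[OF has_field_derivative_at_within[OF d1]])
    then have "integral {a..b} (\<lambda>x. iexp (\<phi> x)) = integral {a..c} (\<lambda>x. iexp (\<phi> x)) + integral {c..b} (\<lambda>x. iexp (\<phi> x))"
      using c by (intro Henstock_Kurzweil_Integration.integral_combine[symmetric] integrable_continuous_real continuous_intros) auto
    then show ?thesis
      using L R norm_triangle_ineq[of "integral {a..c} (\<lambda>x. iexp (\<phi> x))" "integral {c..b} (\<lambda>x. iexp (\<phi> x))"]
      by simp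
  qed
qed

section \<open>Convexity of the symbol on positive frequencies\<close>

lemma weighted_AM_GM_quarter:
  fixes a b :: real
  assumes "a > 0" "b > 0"
  shows "4 * (a powr (1/4) * b powr (3/4)) \<le> a + 3 * b"
proof -
  define u v where "u = a powr (1/4)" and "v = b powr (1/4)"
  have uv: "u ^ 4 = a" "v ^ 4 = b" "v ^ 3 = b powr (3/4)" "u \<ge> 0" "v \<ge> 0"
    using assms by (simp_all add: u_def v_def powr_power)
  \<comment> \<open>Equality at \<open>u = v\<close> is a double root, so
    \<open>(u - v)\<^sup>2\<close> factors out.\<close>
  have "u ^ 4 + 3 * v ^ 4 - 4 * (u * v ^ 3) = (u - v)\<^sup>2 * (u\<^sup>2 + 2 * u * v + 3 * v\<^sup>2)"
    by algebra
  also have "\<dots> \<ge> 0" using uv by (intro mult_nonneg_nonneg add_nonneg_nonneg) auto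
  finally show ?thesis unfolding uv(1,2) unfolding uv(3) by (simp add: u_def)
qed

text \<open>The right side is \<open>m''(k)\<close>. With weights 1 and 3 on
  \<open>\<gamma> / k ^ 3\<close> and \<open>\<delta> * k\<close> the powers of \<open>k\<close>
  cancel. Equality holds at \<open>k ^ 4 = \<gamma> / \<delta>\<close>, so the left side is the
  actual minimum.\<close>

lemma symbol_second_derivative_lower_bound:
  fixes \<beta> \<gamma> \<delta> k :: real
  assumes "\<gamma> > 0" "\<delta> > 0" "k > 0"
  shows "8 * \<gamma> powr (1/4) * \<delta> powr (3/4) - 2 * \<beta> \<le> 2 * \<gamma> / k ^ 3 - 2 * \<beta> + 6 * \<delta> * k"
proof -
  have "4 * ((\<gamma> / k ^ 3) powr (1/4) * (\<delta> * k) powr (3/4)) \<le> \<gamma> / k ^ 3 + 3 * (\<delta> * k)"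
    using assms by (intro weighted_AM_GM_quarter) auto
  moreover have "(\<gamma> / k ^ 3) powr (1/4) * (\<delta> * k) powr (3/4) = \<gamma> powr (1/4) * \<delta> powr (3/4)"
    using assms by (simp add: powr_divide powr_mult powr_powr flip: powr_numeral)
  ultimately show ?thesis by simp
qed

lemma symbol_uminus: "symbol \<alpha> \<beta> \<gamma> \<delta> (- k) = - symbol \<alpha> \<beta> \<gamma> \<delta> k"
  by (simp add: symbol_def)

lemma borel_measurable_symbol [measurable]: "symbol \<alpha> \<beta> \<gamma> \<delta> \<in> borel_measurable borel"
  unfolding symbol_def by measurable

section \<open>Dispersive decay\<close>

lemma set_integrable_unimodular:
  fixes h :: "real \<Rightarrow> complex"
  assumes [measurable]: "h \<in> borel_measurable borel" and h: "\<And>k. norm (h k) = 1"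
    and S: "S \<in> sets borel" "bounded S"
  shows "set_integrable lborel S h"
proof -
  have "emeasure lborel S < \<infinity>" using emeasure_bounded_finite[OF S(2)] .
  then have "integrable lborel (indicat_real S)" using S by auto
  then show ?thesis
    unfolding set_integrable_def
    by (rule Bochner_Integration.integrable_bound) (use S h in \<open>auto simp: indicator_def\<close>)
qed

text \<open>Away from the pole of \<open>\<gamma> / k\<close> the phase is smooth and
  \<open>k * |k|\<close> is \<open>k\<^sup>2\<close>. The term \<open>y * k\<close> is affine and
  leaves no trace in the second derivative, whence the uniformity in \<open>y\<close>.\<close>

lemma oscillatory_integral_bound_away:
  fixes \<alpha> \<beta> \<gamma> \<delta> :: real
  assumes \<kappa>: "\<kappa> > 0" "\<And>k. k > 0 \<Longrightarrow> \<kappa> \<le> 2 * \<gamma> / k ^ 3 - 2 * \<beta> + 6 * \<delta> * k"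
    and "0 < \<epsilon>" "\<epsilon> \<le> n" "\<tau> > 0"
  shows "norm (integral {\<epsilon>..n} (\<lambda>k. iexp (\<tau> * symbol \<alpha> \<beta> \<gamma> \<delta> k - y * k))) \<le> 8 / sqrt (\<kappa> * \<tau>)"
proof -
  have "norm (integral {\<epsilon>..n} (\<lambda>k. iexp (\<tau> * (\<gamma> / k + \<alpha> * k - \<beta> * k\<^sup>2 + \<delta> * k ^ 3) - y * k))) \<le> 8 / sqrt (\<kappa> * \<tau>)"
  proof (rule van_der_Corput_second[where
        p="\<lambda>k. \<tau> * (- \<gamma> / k\<^sup>2 + \<alpha> - 2 * \<beta> * k + 3 * \<delta> * k\<^sup>2) - y" and
        r="\<lambda>k. \<tau> * (2 * \<gamma> / k ^ 3 - 2 * \<beta> + 6 * \<delta> * k)"])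
    fix k assume "k \<in> {\<epsilon>..n}"
    then have k: "k > 0" using assms by auto
    show "((\<lambda>k. \<tau> * (\<gamma> / k + \<alpha> * k - \<beta> * k\<^sup>2 + \<delta> * k ^ 3) - y * k) has_real_derivative
        \<tau> * (- \<gamma> / k\<^sup>2 + \<alpha> - 2 * \<beta> * k + 3 * \<delta> * k\<^sup>2) - y) (at k)"
      using k by (auto intro!: derivative_eq_intros simp: power2_eq_square)
    show "((\<lambda>k. \<tau> * (- \<gamma> / k\<^sup>2 + \<alpha> - 2 * \<beta> * k + 3 * \<delta> * k\<^sup>2) - y) has_real_derivative
        \<tau> * (2 * \<gamma> / k ^ 3 - 2 * \<beta> + 6 * \<delta> * k)) (at k)"
      using k by (auto intro!: derivative_eq_intros simp: field_simps power2_eq_square power3_eq_cube)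
    show "\<kappa> * \<tau> \<le> \<tau> * (2 * \<gamma> / k ^ 3 - 2 * \<beta> + 6 * \<delta> * k)"
      using \<kappa>(2)[OF k] \<open>\<tau> > 0\<close> by (metis mult.commute mult_left_mono order_less_imp_le)
  qed (use assms in \<open>auto intro!: continuous_intros\<close>)
  also have "integral {\<epsilon>..n} (\<lambda>k. iexp (\<tau> * (\<gamma> / k + \<alpha> * k - \<beta> * k\<^sup>2 + \<delta> * k ^ 3) - y * k)) =
     integral {\<epsilon>..n} (\<lambda>k. iexp (\<tau> * symbol \<alpha> \<beta> \<gamma> \<delta> k - y * k))"
    using assms by (intro Henstock_Kurzweil_Integration.integral_cong) (auto simp: symbol_def power2_eq_square mult.assoc)
  finally show ?thesis .
qed

text \<open>The integrand has modulus 1, so the piece next to the pole costs at most its length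
  \<open>\<epsilon>\<close>, which can be made arbitrarily small.\<close>

lemma oscillatory_integral_bound_half:
  fixes \<alpha> \<beta> \<gamma> \<delta> :: real
  assumes \<kappa>: "\<kappa> > 0" "\<And>k. k > 0 \<Longrightarrow> \<kappa> \<le> 2 * \<gamma> / k ^ 3 - 2 * \<beta> + 6 * \<delta> * k"
    and \<tau>: "\<tau> \<noteq> 0" and n: "n > 0"
  shows "norm (CLINT k:{0..n}|lborel. iexp (y * k - \<tau> * symbol \<alpha> \<beta> \<gamma> \<delta> k)) \<le> 8 / sqrt (\<kappa> * \<bar>\<tau>\<bar>)"
proof (rule field_le_epsilon)
  fix e :: real assume e: "e > 0"
  define \<epsilon> where "\<epsilon> = min e n"
  have \<epsilon>: "0 < \<epsilon>" "\<epsilon> \<le> e" "\<epsilon> \<le> n" using e n by (auto simp: \<epsilon>_def)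
  let ?h = "\<lambda>k. iexp (y * k - \<tau> * symbol \<alpha> \<beta> \<gamma> \<delta> k)"
  have si: "set_integrable lborel S ?h" if "S \<in> sets borel" "bounded S" for S
    by (rule set_integrable_unimodular) (use that in auto)
  have "norm (integral {\<epsilon>..n} ?h) \<le> 8 / sqrt (\<kappa> * \<bar>\<tau>\<bar>)"
  \<comment> \<open>The second derivative of the phase has the sign of \<open>- \<tau>\<close>. For
    positive \<open>\<tau>\<close> conjugation makes it positive; for negative \<open>\<tau>\<close>
    the previous lemma applies with \<open>- \<tau>\<close> and \<open>- y\<close>.\<close>
  proof (cases "\<tau> > 0")
    case True
    have "?h = cnj \<circ> (\<lambda>k. iexp (\<tau> * symbol \<alpha> \<beta> \<gamma> \<delta> k - y * k))"
      by (auto simp: exp_cnj fun_eq_iff algebra_simps)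
    then have "norm (integral {\<epsilon>..n} ?h) = norm (cnj (integral {\<epsilon>..n} (\<lambda>k. iexp (\<tau> * symbol \<alpha> \<beta> \<gamma> \<delta> k - y * k))))"
      unfolding Henstock_Kurzweil_Integration.integral_cnj by (simp add: o_def)
    then show ?thesis
      using oscillatory_integral_bound_away[OF \<kappa> \<epsilon>(1,3) True, of \<alpha> y] True by simp
  next
    case False
    then show ?thesis
      using oscillatory_integral_bound_away[OF \<kappa> \<epsilon>(1,3), of "- \<tau>" \<alpha> "- y"] \<tau>
      by (simp add: algebra_simps)
  qed
  then have far: "norm (CLINT k:{\<epsilon>..n}|lborel. ?h k) \<le> 8 / sqrt (\<kappa> * \<bar>\<tau>\<bar>)"
    by (subst set_borel_integral_eq_integral(2)) (rule si; simp)+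
  have "norm (CLINT k:{0..<\<epsilon>}|lborel. ?h k) \<le> (LINT k:{0..<\<epsilon>}|lborel. norm (?h k))"
    by (rule set_integral_norm_bound, rule si) auto
  also have "\<dots> = \<epsilon>" using \<epsilon> by (simp add: set_lebesgue_integral_def)
  finally have near: "norm (CLINT k:{0..<\<epsilon>}|lborel. ?h k) \<le> \<epsilon>" .
  have "{0..n} = {0..<\<epsilon>} \<union> {\<epsilon>..n}" using \<epsilon> by auto
  then have "(CLINT k:{0..n}|lborel. ?h k) = (CLINT k:{0..<\<epsilon>}|lborel. ?h k) + (CLINT k:{\<epsilon>..n}|lborel. ?h k)"
    by (simp only:) (rule set_integral_Un; (rule si)?; auto)
  then have "norm (CLINT k:{0..n}|lborel. ?h k) \<le> norm (CLINT k:{0..<\<epsilon>}|lborel. ?h k) + norm (CLINT k:{\<epsilon>..n}|lborel. ?h k)"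
    by (simp only: norm_triangle_ineq)
  then show "norm (CLINT k:{0..n}|lborel. ?h k) \<le> 8 / sqrt (\<kappa> * \<bar>\<tau>\<bar>) + e"
    using near far \<epsilon> by linarith
qed

text \<open>The phase is odd in \<open>k\<close>, so the integral over negative frequencies is the
  conjugate of the one over \<open>{0..n}\<close>, and the constant 8 doubles.\<close>

lemma dispersive_kernel_bound:
  fixes \<alpha> \<beta> \<gamma> \<delta> :: real
  assumes \<kappa>: "\<kappa> > 0" "\<And>k. k > 0 \<Longrightarrow> \<kappa> \<le> 2 * \<gamma> / k ^ 3 - 2 * \<beta> + 6 * \<delta> * k"
    and \<tau>: "\<tau> \<noteq> 0" and n: "n > 0"
  shows "norm (CLINT k:{-n..n}|lborel. iexp (y * k - \<tau> * symbol \<alpha> \<beta> \<gamma> \<delta> k)) \<le> 16 / sqrt \<kappa> * \<bar>\<tau>\<bar> powr (-1/2)"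
proof -
  define h where "h k = iexp (y * k - \<tau> * symbol \<alpha> \<beta> \<gamma> \<delta> k)" for k
  have [measurable]: "h \<in> borel_measurable borel" unfolding h_def by measurable
  have int: "integrable lborel (\<lambda>k. indicator {0..n} k *\<^sub>R h k)"
    using set_integrable_unimodular[of h "{0..n}"] by (simp add: set_integrable_def h_def)
  have refl: "indicator {0..n} (- k) *\<^sub>R h k = cnj (indicator {0..n} (- k) *\<^sub>R h (- k))" for k
    by (simp add: h_def symbol_uminus exp_cnj algebra_simps)
  have int': "integrable lborel (\<lambda>k. indicator {0..n} (- k) *\<^sub>R h k)"
    unfolding refl using lborel_integrable_real_affine[OF int, of "-1" 0] by (auto simp del: complex_cnj_scaleR)
  have "(\<integral>k. indicator {0..n} (- k) *\<^sub>R h k \<partial>lborel) = cnj (\<integral>k. indicator {0..n} (- k) *\<^sub>R h (- k) \<partial>lborel)"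
    unfolding refl by (rule Bochner_Integration.integral_cnj)
  also have "(\<integral>k. indicator {0..n} (- k) *\<^sub>R h (- k) \<partial>lborel) = (\<integral>k. indicator {0..n} k *\<^sub>R h k \<partial>lborel)"
    using lborel_integral_real_affine[of "-1" "\<lambda>k. indicator {0..n} k *\<^sub>R h k" 0] by simp
  finally have eq: "(\<integral>k. indicator {0..n} (- k) *\<^sub>R h k \<partial>lborel) = cnj (\<integral>k. indicator {0..n} k *\<^sub>R h k \<partial>lborel)" .
  have "(\<integral>k. indicator {-n..n} k *\<^sub>R h k \<partial>lborel) =
      (\<integral>k. indicator {0..n} k *\<^sub>R h k + indicator {0..n} (- k) *\<^sub>R h k \<partial>lborel)"
  \<comment> \<open>The two halves overlap only at \<open>k = 0\<close>, a null set.\<close>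
  proof (rule integral_cong_AE)
    show "AE k in lborel. indicator {-n..n} k *\<^sub>R h k = indicator {0..n} k *\<^sub>R h k + indicator {0..n} (- k) *\<^sub>R h k"
      using AE_lborel_singleton[of "0::real"] by eventually_elim (use n in \<open>auto simp: indicator_def\<close>)
  qed measurable
  also have "\<dots> = (\<integral>k. indicator {0..n} k *\<^sub>R h k \<partial>lborel) + cnj (\<integral>k. indicator {0..n} k *\<^sub>R h k \<partial>lborel)"
    by (simp add: Bochner_Integration.integral_add[OF int int'] eq del: complex_cnj_scaleR)
  finally have "norm (CLINT k:{-n..n}|lborel. h k) \<le> 2 * norm (CLINT k:{0..n}|lborel. h k)"
    unfolding set_lebesgue_integral_def by (metis complex_mod_cnj mult_2 norm_triangle_ineq)
  also have "\<dots> \<le> 2 * (8 / sqrt (\<kappa> * \<bar>\<tau>\<bar>))"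
    unfolding h_def by (intro mult_left_mono oscillatory_integral_bound_half assms) auto
  also have "\<dots> = 16 / sqrt \<kappa> * \<bar>\<tau>\<bar> powr (-1/2)"
    using \<kappa>(1) \<tau> by (simp add: real_sqrt_mult powr_minus powr_half_sqrt field_simps)
  finally show ?thesis unfolding h_def .
qed

section \<open>Linearized and maximal estimates\<close>

text \<open>With the Fourier transform of the datum as \<open>F\<close>, this is the solution
  restricted to frequencies in \<open>{-n..n}\<close>, up to the factor \<open>1 / (2 * pi)\<close>,
  which is restored only for the limit.\<close>

definition propagator :: "(real \<Rightarrow> real) \<Rightarrow> real \<Rightarrow> (real \<Rightarrow> complex) \<Rightarrow> real \<Rightarrow> real \<Rightarrow> complex" where
  "propagator m n F t x = (CLINT k:{-n..n}|lborel. iexp (x * k - t * m k) * F k)"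

lemma finite_measure_density_indicator:
  fixes S :: "real set"
  assumes "S \<in> sets borel" "bounded S"
  shows "finite_measure (density lborel (\<lambda>k. ennreal (indicator S k)))"
  using emeasure_bounded_finite[OF assms(2)] assms(1)
  by (intro finite_measureI) (auto simp: emeasure_density ennreal_indicator)

lemma square_integrable_imp_integrable:
  assumes "finite_measure M" "F \<in> borel_measurable M"
    and "(\<integral>\<^sup>+k. ennreal ((norm (F k :: complex))\<^sup>2) \<partial>M) < \<infinity>"
  shows "integrable M F"
proof -
  interpret finite_measure M by fact
  have [measurable]: "F \<in> borel_measurable M" by fact
  have "integrable M (\<lambda>k. (norm (F k))\<^sup>2)"
    using assms by (intro integrableI_nonneg) auto
  then have "integrable M (\<lambda>k. 1 + (norm (F k))\<^sup>2)" by simp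
  then show ?thesis
  proof (rule Bochner_Integration.integrable_bound)
    have "norm (F k) \<le> 1 + (norm (F k))\<^sup>2" for k
      using sum_power2_ge_zero[of "norm (F k) - 1" 0] by (simp add: power2_diff) (smt (verit) zero_le_power2)
    then show "AE k in M. norm (F k) \<le> norm (1 + (norm (F k))\<^sup>2)" by auto
  qed measurable
qed

text \<open>For a fixed trajectory \<open>x\<close> the evaluation at \<open>(t, x t)\<close> is
  linear in \<open>F\<close>, so duality applies. The bound is independent of \<open>x\<close>,
  \<open>n\<close> and \<open>T\<close>. In its constant, \<open>C\<close> comes from the kernel and
  14 from \<open>hardy_littlewood_sobolev\<close>.\<close>

lemma strichartz_linearized:
  fixes m x :: "real \<Rightarrow> real" and F :: "real \<Rightarrow> complex"
  assumes [measurable]: "m \<in> borel_measurable borel" "x \<in> borel_measurable borel" "F \<in> borel_measurable borel"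
    and C: "C > 0"
    and K: "\<And>y \<tau>. \<tau> \<noteq> 0 \<Longrightarrow> norm (CLINT k:{-n..n}|lborel. iexp (y * k - \<tau> * m k)) \<le> C * \<bar>\<tau>\<bar> powr (-1/2)"
    and P: "(\<integral>\<^sup>+k. ennreal ((norm (F k))\<^sup>2) \<partial>lborel) = ennreal P" "P \<ge> 0"
  shows "(\<integral>\<^sup>+t. ennreal (norm (propagator m n F t (x t)) ^ 4) * indicator {0..T} t \<partial>lborel) \<le> ennreal ((14 * C * P)\<^sup>2)"
proof -
  \<comment> \<open>The frequency and time windows become finite measures, as the abstract lemmas
    require; their total masses do not enter the final bound.\<close>
  define A where "A = density lborel (\<lambda>k. ennreal (indicator {-n..n} k))"
  define B where "B = density lborel (\<lambda>k. ennreal (indicator {0..T} k))"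
  have sets_A [measurable_cong]: "sets A = sets borel" and sets_B [measurable_cong]: "sets B = sets borel"
    by (simp_all add: A_def B_def)
  interpret A: finite_measure A unfolding A_def by (rule finite_measure_density_indicator) auto
  interpret B: finite_measure B unfolding B_def by (rule finite_measure_density_indicator) auto
  interpret BA: pair_sigma_finite B A ..
  interpret AB: pair_sigma_finite A B ..
  have nnB: "(\<integral>\<^sup>+t. f t \<partial>B) = (\<integral>\<^sup>+t. ennreal (indicator {0..T} t) * f t \<partial>lborel)"
    if "f \<in> borel_measurable borel" for f
    unfolding B_def by (subst nn_integral_density) (use that in auto)
  define e where "e t k = iexp (x t * k - t * m k)" for t k
  have em [measurable]: "(\<lambda>(t, k). e t k) \<in> borel_measurable (B \<Otimes>\<^sub>M A)" unfolding e_def by measurable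
  have em' [measurable]: "(\<lambda>(k, t). e t k) \<in> borel_measurable (A \<Otimes>\<^sub>M B)" unfolding e_def by measurable
  have e1: "norm (e t k) \<le> 1" for t k by (simp add: e_def)
  have FA: "(\<integral>\<^sup>+k. ennreal ((norm (F k))\<^sup>2) \<partial>A) \<le> ennreal P"
    unfolding A_def P(1)[symmetric]
    by (subst nn_integral_density) (auto intro!: nn_integral_mono simp: indicator_def)
  have Fint: "integrable A F"
    by (rule square_integrable_imp_integrable) (use FA A.finite_measure_axioms in \<open>auto simp: less_top[symmetric] top_unique\<close>)
  define u where "u t = (\<integral>k. e t k * F k \<partial>A)" for t
  have u_eq: "u t = propagator m n F t (x t)" for t
    unfolding u_def A_def propagator_def set_lebesgue_integral_def e_def
    by (subst integral_density) auto
  have [measurable]: "u \<in> borel_measurable borel"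
    unfolding u_def e_def by measurable
  define b where "b = (\<integral>k. norm (F k) \<partial>A)"
  have b: "norm (u t) \<le> b" for t
  proof -
    have "norm (u t) \<le> (\<integral>k. norm (e t k * F k) \<partial>A)" unfolding u_def by (rule integral_norm_bound)
    also have "\<dots> \<le> b" unfolding b_def using Fint
      by (intro integral_mono_AE') (auto simp: norm_mult e_def)
    finally show ?thesis .
  qed
  \<comment> \<open>Extension of \<open>|u|\<close> by zero outside the time window, so that the
    inequality on the whole line applies.\<close>
  define w where "w t = norm (u t) * indicator {0..T} t" for t
  have [measurable]: "w \<in> borel_measurable borel" unfolding w_def by measurable
  have w0: "w t \<ge> 0" for t by (simp add: w_def)
  define H where "H t = cnj (u t) * complex_of_real ((norm (u t))\<^sup>2)" for t
  have [measurable]: "H \<in> borel_measurable borel" unfolding H_def by measurable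
  have normH: "norm (H t) = norm (u t) ^ 3" for t
    by (simp add: H_def norm_mult norm_power power2_eq_square power3_eq_cube)
  have Hb: "norm (H t) \<le> b ^ 3" for t unfolding normH by (intro power_mono b) auto
  have Hint: "integrable B H"
    by (rule B.integrable_const_bound[where B="b ^ 3"]) (auto simp: Hb)
  have u4: "integrable B (\<lambda>t. norm (u t) ^ 4)"
    by (rule B.integrable_const_bound[where B="b ^ 4"]) (auto intro!: power_mono b)
  define N where "N = (\<integral>t. norm (u t) ^ 4 \<partial>B)"
  have N_eq: "(\<integral>\<^sup>+t. ennreal (norm (u t) ^ 4) \<partial>B) = ennreal N"
    unfolding N_def by (rule nn_integral_eq_integral[OF u4]) auto
  have w4: "(\<integral>\<^sup>+t. ennreal (w t ^ 4) \<partial>lborel) = ennreal N"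
    unfolding N_eq[symmetric] B_def
    by (subst nn_integral_density) (auto intro!: nn_integral_cong simp: w_def indicator_def)
  have lhs: "(\<integral>\<^sup>+t. ennreal (norm (propagator m n F t (x t)) ^ 4) * indicator {0..T} t \<partial>lborel) = ennreal N"
    unfolding w4[symmetric] u_eq[symmetric]
    by (intro nn_integral_cong) (auto simp: w_def indicator_def)
  have N0: "N \<ge> 0" unfolding N_def by auto
  define D where "D = 14 * C"
  have D: "D > 0" using C by (simp add: D_def)
  have "N \<le> (D * P)\<^sup>2"
  proof (cases "N = 0")
    case False
    then have N: "N > 0" using N0 by simp
    define G where "G k = (\<integral>t. e t k * H t \<partial>B)" for k
    have [measurable]: "G \<in> borel_measurable A" unfolding G_def by measurable
    have "complex_of_real N = (\<integral>t. u t * H t \<partial>B)"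
      unfolding N_def integral_complex_of_real[symmetric]
      by (simp add: H_def complex_norm_square[symmetric] mult.assoc[symmetric] flip: of_real_mult)
    also have "\<dots> = (\<integral>k. F k * G k \<partial>A)"
      unfolding u_def G_def
      by (intro AB.integral_swap_bounded_kernel[where B="b ^ 3" and e="\<lambda>k t. e t k"])
         (use B.finite_measure_axioms em' Fint e1 Hb in auto)
    finally have "ennreal N = ennreal (norm (\<integral>k. F k * G k \<partial>A))"
      using N0 by (metis abs_of_nonneg norm_of_real)
    also have "\<dots> \<le> (\<integral>\<^sup>+k. ennreal (norm (F k * G k)) \<partial>A)" by (rule ennreal_norm_integral_le)
    also have "\<dots> \<le> (\<integral>\<^sup>+k. ennreal (D * sqrt N / 2) * ennreal ((norm (F k))\<^sup>2)
         + ennreal (1 / (2 * (D * sqrt N))) * ennreal ((norm (G k))\<^sup>2) \<partial>A)"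
    proof (intro nn_integral_mono)
      fix k
      \<comment> \<open>Cauchy-Schwarz in the form of AM-GM. The energy of \<open>G\<close> is at
        most \<open>D * sqrt N * N\<close>, so with this weight the second term is at most
        \<open>N / 2\<close> and is absorbed on the left.\<close>
      define a where "a = D * sqrt N"
      have a: "a > 0" using D N by (simp add: a_def)
      have "0 \<le> (a * norm (F k) - norm (G k))\<^sup>2 / (2 * a)" using a by simp
      also have "\<dots> = a / 2 * (norm (F k))\<^sup>2 + 1 / (2 * a) * (norm (G k))\<^sup>2 - norm (F k) * norm (G k)"
        using a by (simp add: field_simps power2_eq_square)
      finally have "norm (F k * G k) \<le> a / 2 * (norm (F k))\<^sup>2 + 1 / (2 * a) * (norm (G k))\<^sup>2"
        by (simp add: norm_mult)
      then have "ennreal (norm (F k * G k)) \<le> ennreal (a / 2 * (norm (F k))\<^sup>2 + 1 / (2 * a) * (norm (G k))\<^sup>2)"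
        by (rule ennreal_leI)
      also have "\<dots> = ennreal (a / 2) * ennreal ((norm (F k))\<^sup>2) + ennreal (1 / (2 * a)) * ennreal ((norm (G k))\<^sup>2)"
        using a by (simp flip: ennreal_mult ennreal_plus)
      finally show "ennreal (norm (F k * G k)) \<le> ennreal (D * sqrt N / 2) * ennreal ((norm (F k))\<^sup>2)
         + ennreal (1 / (2 * (D * sqrt N))) * ennreal ((norm (G k))\<^sup>2)" unfolding a_def .
    qed
    also have "\<dots> = ennreal (D * sqrt N / 2) * (\<integral>\<^sup>+k. ennreal ((norm (F k))\<^sup>2) \<partial>A)
         + ennreal (1 / (2 * (D * sqrt N))) * (\<integral>\<^sup>+k. ennreal ((norm (G k))\<^sup>2) \<partial>A)"
      by (simp add: nn_integral_add nn_integral_cmult)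
    also have "(\<integral>\<^sup>+k. ennreal ((norm (G k))\<^sup>2) \<partial>A) \<le> ennreal (D * (sqrt N * N))"
    proof -
      have "(\<integral>\<^sup>+k. ennreal ((norm (G k))\<^sup>2) \<partial>A) \<le>
        (\<integral>\<^sup>+t. \<integral>\<^sup>+s. ennreal (norm (H t) * norm (H s) * norm (\<integral>k. e t k * cnj (e s k) \<partial>A)) \<partial>B \<partial>B)"
        unfolding G_def by (intro BA.TT_star_bound A.finite_measure_axioms em Hint e1)
      also have "\<dots> \<le> (\<integral>\<^sup>+t. \<integral>\<^sup>+s. ennreal C * ennreal (w t ^ 3 * w s ^ 3 * \<bar>t - s\<bar> powr (-1/2)) \<partial>lborel \<partial>lborel)"
      proof -
        have inner: "(\<integral>\<^sup>+s. ennreal (norm (H t) * norm (H s) * norm (\<integral>k. e t k * cnj (e s k) \<partial>A)) \<partial>B) * ennreal (indicator {0..T} t)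
            \<le> (\<integral>\<^sup>+s. ennreal C * ennreal (w t ^ 3 * w s ^ 3 * \<bar>t - s\<bar> powr (-1/2)) \<partial>lborel)" for t
        proof -
          have [measurable]: "(\<lambda>s. \<integral>k. e t k * cnj (e s k) \<partial>A) \<in> borel_measurable borel"
            unfolding e_def by measurable
          \<comment> \<open>The composed kernel is the oscillatory integral at time
            \<open>t - s\<close> and position \<open>x t - x s\<close>. Uniformity of
            \<open>K\<close> in \<open>y\<close> is what makes an arbitrary trajectory
            harmless.\<close>
          have ker: "norm (\<integral>k. e t k * cnj (e s k) \<partial>A) \<le> C * \<bar>t - s\<bar> powr (-1/2)" if "s \<noteq> t" for s
          proof -
            have "e t k * cnj (e s k) = iexp ((x t - x s) * k - (t - s) * m k)" for k
              by (simp add: e_def exp_cnj exp_add[symmetric] algebra_simps)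
            then have "(\<integral>k. e t k * cnj (e s k) \<partial>A) = (CLINT k:{-n..n}|lborel. iexp ((x t - x s) * k - (t - s) * m k))"
              unfolding A_def set_lebesgue_integral_def
              by (simp only:) (subst integral_density, auto)
            then show ?thesis using K[of "t - s" "x t - x s"] that by simp
          qed
          have "(\<integral>\<^sup>+s. ennreal (norm (H t) * norm (H s) * norm (\<integral>k. e t k * cnj (e s k) \<partial>A)) \<partial>B) * ennreal (indicator {0..T} t)
             = (\<integral>\<^sup>+s. ennreal (indicator {0..T} s) * ennreal (norm (H t) * norm (H s) * norm (\<integral>k. e t k * cnj (e s k) \<partial>A)) * ennreal (indicator {0..T} t) \<partial>lborel)"
            unfolding B_def by (subst nn_integral_density) (auto simp: nn_integral_multc)
          also have "\<dots> \<le> (\<integral>\<^sup>+s. ennreal C * ennreal (w t ^ 3 * w s ^ 3 * \<bar>t - s\<bar> powr (-1/2)) \<partial>lborel)"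
          proof (rule nn_integral_mono_AE, use AE_lborel_singleton[of t] in eventually_elim)
            fix s assume st: "s \<noteq> t"
            show "ennreal (indicator {0..T} s) * ennreal (norm (H t) * norm (H s) * norm (\<integral>k. e t k * cnj (e s k) \<partial>A)) * ennreal (indicator {0..T} t)
              \<le> ennreal C * ennreal (w t ^ 3 * w s ^ 3 * \<bar>t - s\<bar> powr (-1/2))"
            proof (cases "s \<in> {0..T} \<and> t \<in> {0..T}")
              case True
              have "norm (H t) * norm (H s) * norm (\<integral>k. e t k * cnj (e s k) \<partial>A)
                \<le> norm (H t) * norm (H s) * (C * \<bar>t - s\<bar> powr (-1/2))"
                by (intro mult_left_mono ker st) auto
              also have "\<dots> = C * (w t ^ 3 * w s ^ 3 * \<bar>t - s\<bar> powr (-1/2))"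
                using True by (simp add: w_def normH)
              finally show ?thesis using True C by (simp flip: ennreal_mult' add: ennreal_leI)
            qed auto
          qed
          finally show ?thesis .
        qed
        have [measurable]: "(\<lambda>(t, s). \<integral>k. e t k * cnj (e s k) \<partial>A) \<in> borel_measurable (borel \<Otimes>\<^sub>M borel)"
          unfolding e_def by measurable
        have [measurable]: "(\<lambda>t. \<integral>\<^sup>+s. ennreal (norm (H t) * norm (H s) * norm (\<integral>k. e t k * cnj (e s k) \<partial>A)) \<partial>B) \<in> borel_measurable borel"
          by measurable
        have "(\<integral>\<^sup>+t. \<integral>\<^sup>+s. ennreal (norm (H t) * norm (H s) * norm (\<integral>k. e t k * cnj (e s k) \<partial>A)) \<partial>B \<partial>B)
          = (\<integral>\<^sup>+t. (\<integral>\<^sup>+s. ennreal (norm (H t) * norm (H s) * norm (\<integral>k. e t k * cnj (e s k) \<partial>A)) \<partial>B) * ennreal (indicator {0..T} t) \<partial>lborel)"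
          by (rule trans[OF nnB]) (auto simp: mult.commute)
        also have "\<dots> \<le> (\<integral>\<^sup>+t. \<integral>\<^sup>+s. ennreal C * ennreal (w t ^ 3 * w s ^ 3 * \<bar>t - s\<bar> powr (-1/2)) \<partial>lborel \<partial>lborel)"
          by (intro nn_integral_mono inner)
        finally show ?thesis .
      qed
      also have "\<dots> = ennreal C * (\<integral>\<^sup>+t. \<integral>\<^sup>+s. ennreal (w t ^ 3 * w s ^ 3 * \<bar>t - s\<bar> powr (-1/2)) \<partial>lborel \<partial>lborel)"
        by (simp add: nn_integral_cmult)
      also have "\<dots> \<le> ennreal C * ennreal (14 * sqrt N * N)"
        by (intro mult_left_mono hardy_littlewood_sobolev[OF _ w0 w4 N]) auto
      also have "\<dots> = ennreal (D * (sqrt N * N))"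
        using C N by (simp add: D_def mult_ac flip: ennreal_mult)
      finally show ?thesis .
    qed
    also note FA
    finally have "ennreal N \<le> ennreal (D * sqrt N / 2) * ennreal P
         + ennreal (1 / (2 * (D * sqrt N))) * ennreal (D * (sqrt N * N))"
      by (simp add: add_mono mult_left_mono)
    also have "\<dots> = ennreal (D * sqrt N / 2 * P + N / 2)"
      using D N P by (simp flip: ennreal_mult ennreal_plus add: field_simps)
    finally have "ennreal N \<le> ennreal (D * sqrt N / 2 * P + N / 2)" .
    then have "N \<le> D * sqrt N / 2 * P + N / 2"
      by (rule ennreal_le_iff[THEN iffD1, rotated]) (use D N P in simp)
    then have "sqrt N * sqrt N \<le> (D * P) * sqrt N" using N by (simp add: field_simps)
    then have "sqrt N \<le> D * P" by (rule mult_right_le_imp_le) (use N in simp)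
    then show ?thesis by (rule sqrt_le_D)
  qed simp
  then show ?thesis unfolding lhs by (simp add: D_def ennreal_leI)
qed

text \<open>
  A measurable choice of a maximizing position: linearizes the supremum over \<open>r 0, \<dots>, r j\<close>.
\<close>

primrec running_argmax :: "(real \<Rightarrow> real \<Rightarrow> real) \<Rightarrow> (nat \<Rightarrow> real) \<Rightarrow> nat \<Rightarrow> real \<Rightarrow> real" where
  "running_argmax V r 0 t = r 0"
| "running_argmax V r (Suc j) t =
     (if V t (running_argmax V r j t) < V t (r (Suc j)) then r (Suc j) else running_argmax V r j t)"

lemma borel_measurable_running_argmax:
  assumes [measurable]: "(\<lambda>(t, x). V t x) \<in> borel_measurable (borel \<Otimes>\<^sub>M borel)"
  shows "running_argmax V r j \<in> borel_measurable borel"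
proof (induction j)
  case (Suc j)
  note [measurable] = this
  show ?case by (simp add: running_argmax.simps[abs_def])
qed (simp add: running_argmax.simps[abs_def])

lemma running_argmax_incseq: "incseq (\<lambda>j. V t (running_argmax V r j t))"
  by (rule incseq_SucI) auto

lemma running_argmax_upper: "i \<le> j \<Longrightarrow> V t (r i) \<le> V t (running_argmax V r j t)"
  by (induction j) (auto simp: le_Suc_eq)

lemma borel_measurable_propagator [measurable]:
  assumes [measurable]: "m \<in> borel_measurable borel" "F \<in> borel_measurable borel"
  shows "(\<lambda>(t, x). propagator m n F t x) \<in> borel_measurable (borel \<Otimes>\<^sub>M borel)"
  unfolding propagator_def set_lebesgue_integral_def by measurable

lemma truncation_integrable:
  fixes F :: "real \<Rightarrow> complex"
  assumes [measurable]: "F \<in> borel_measurable borel"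
    and F: "(\<integral>\<^sup>+k. ennreal ((norm (F k))\<^sup>2) \<partial>lborel) < \<infinity>"
    and S: "S \<in> sets borel" "bounded S"
  shows "integrable lborel (\<lambda>k. indicator S k *\<^sub>R F k)"
proof -
  define A where "A = density lborel (\<lambda>k. ennreal (indicator S k))"
  have [measurable_cong]: "sets A = sets borel" by (simp add: A_def)
  have "(\<integral>\<^sup>+k. ennreal ((norm (F k))\<^sup>2) \<partial>A) \<le> (\<integral>\<^sup>+k. ennreal ((norm (F k))\<^sup>2) \<partial>lborel)"
    unfolding A_def using S(1)
    by (subst nn_integral_density) (auto intro!: nn_integral_mono simp: indicator_def)
  then have "integrable A F"
    using F by (intro square_integrable_imp_integrable finite_measure_density_indicator[OF S, folded A_def])
      (auto simp: A_def)
  then show ?thesis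
    unfolding A_def using S(1) by (subst (asm) integrable_density) auto
qed

text \<open>Dominated convergence with the integrable truncation of \<open>F\<close> as majorant.
  Continuity in \<open>x\<close> lets bounds at rational positions extend to all positions.\<close>

lemma continuous_propagator:
  fixes F :: "real \<Rightarrow> complex"
  assumes [measurable]: "m \<in> borel_measurable borel" "F \<in> borel_measurable borel"
    and F: "(\<integral>\<^sup>+k. ennreal ((norm (F k))\<^sup>2) \<partial>lborel) < \<infinity>"
  shows "continuous_on UNIV (propagator m n F t)"
proof (intro continuous_at_imp_continuous_on ballI)
  fix x :: real
  let ?I = "\<lambda>k. indicator {-n..n} k *\<^sub>R F k"
  have int: "integrable lborel (\<lambda>k. norm (?I k))"
    by (intro integrable_norm truncation_integrable F) auto
  have "isCont (\<lambda>x. \<integral>k. indicator {-n..n} k *\<^sub>R (iexp (x * k - t * m k) * F k) \<partial>lborel) x"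
    unfolding continuous_at_sequentially
  proof (intro allI impI)
    fix X assume X: "X \<longlonglongrightarrow> x"
    show "((\<lambda>x. \<integral>k. indicator {-n..n} k *\<^sub>R (iexp (x * k - t * m k) * F k) \<partial>lborel) \<circ> X)
       \<longlonglongrightarrow> (\<integral>k. indicator {-n..n} k *\<^sub>R (iexp (x * k - t * m k) * F k) \<partial>lborel)"
      unfolding o_def
    proof (rule integral_dominated_convergence[OF _ _ int])
      show "AE k in lborel. (\<lambda>i. indicator {-n..n} k *\<^sub>R (iexp (X i * k - t * m k) * F k))
          \<longlonglongrightarrow> indicator {-n..n} k *\<^sub>R (iexp (x * k - t * m k) * F k)"
        by (intro AE_I2 tendsto_intros X)
    qed (auto simp: norm_mult)
  qed
  then show "isCont (propagator m n F t) x"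
    unfolding propagator_def[abs_def] set_lebesgue_integral_def .
qed

text \<open>The linearized bound does not depend on the trajectory, so it holds for the maximizers
  over finitely many rationals, and monotone convergence carries it to the supremum.
  \<open>S\<close> is built from countably many measurable functions, which settles its
  measurability in time.\<close>

lemma strichartz_maximal:
  fixes m :: "real \<Rightarrow> real" and F :: "real \<Rightarrow> complex"
  assumes m [measurable]: "m \<in> borel_measurable borel" "F \<in> borel_measurable borel"
    and C: "C > 0"
    and K: "\<And>y \<tau>. \<tau> \<noteq> 0 \<Longrightarrow> norm (CLINT k:{-n..n}|lborel. iexp (y * k - \<tau> * m k)) \<le> C * \<bar>\<tau>\<bar> powr (-1/2)"
    and P: "(\<integral>\<^sup>+k. ennreal ((norm (F k))\<^sup>2) \<partial>lborel) = ennreal P" "P \<ge> 0"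
  shows "\<exists>S. S \<in> borel_measurable borel \<and> (\<forall>t x. ennreal (norm (propagator m n F t x) ^ 4) \<le> S t) \<and>
    (\<integral>\<^sup>+t. S t * indicator {0..} t \<partial>lborel) \<le> ennreal ((14 * C * P)\<^sup>2)"
proof -
  define V where "V t x = norm (propagator m n F t x) ^ 4" for t x
  have [measurable]: "(\<lambda>(t, x). V t x) \<in> borel_measurable (borel \<Otimes>\<^sub>M borel)"
    unfolding V_def by measurable
  define r :: "nat \<Rightarrow> real" where "r = from_nat_into \<rat>"
  have r: "closure (range r) = UNIV"
    unfolding r_def using Rats_closure_real by (subst range_from_nat_into) (auto simp: countable_rat)
  define X where "X = running_argmax V r"
  have [measurable]: "X j \<in> borel_measurable borel" for j
    unfolding X_def by (rule borel_measurable_running_argmax) measurable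
  define S where "S t = (SUP j. ennreal (V t (X j t)))" for t
  have [measurable]: "S \<in> borel_measurable borel" unfolding S_def by measurable
  have "ennreal (V t x) \<le> S t" for t x
  proof (cases "S t = \<infinity>")
    case False
    then obtain s where s: "S t = ennreal s" "s \<ge> 0" by (cases "S t") auto
    have "V t (r i) \<le> s" for i
    proof -
      have "ennreal (V t (r i)) \<le> ennreal (V t (X i t))"
        unfolding X_def by (intro ennreal_leI running_argmax_upper) simp
      also have "\<dots> \<le> S t" unfolding S_def by (rule SUP_upper) simp
      finally show ?thesis using s by simp
    qed
    moreover have "closed {x. V t x \<le> s}"
      unfolding V_def
      by (intro closed_Collect_le continuous_intros continuous_propagator m) (simp add: P)
    ultimately have "closure (range r) \<subseteq> {x. V t x \<le> s}"
      by (intro closure_minimal) auto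
    then show ?thesis using r s by (auto intro: ennreal_leI)
  qed simp
  moreover have "(\<integral>\<^sup>+t. S t * indicator {0..} t \<partial>lborel) \<le> ennreal ((14 * C * P)\<^sup>2)"
  proof -
    \<comment> \<open>One index enlarges both the set of competing rationals and the time window, so
      a single monotone limit suffices.\<close>
    let ?f = "\<lambda>j t. ennreal (V t (X j t)) * indicator {0..real j} t"
    have inc: "incseq (\<lambda>j. ennreal (V t (X j t)))" for t
      using running_argmax_incseq[of V t r] by (auto simp: incseq_def X_def intro!: ennreal_leI)
    have sup: "S t * indicator {0..} t = (SUP j. ?f j t)" for t
    proof (cases "t \<ge> 0")
      case True
      have "S t \<le> (SUP j. ?f j t)"
        unfolding S_def
      proof (rule SUP_mono)
        fix j
        obtain i where "real i \<ge> t" using real_arch_simple by blast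
        then have "ennreal (V t (X j t)) \<le> ?f (max i j) t"
          using incseqD[OF inc, of j "max i j" t] True by (auto simp: indicator_def)
        then show "\<exists>i\<in>UNIV. ennreal (V t (X j t)) \<le> ?f i t" by blast
      qed
      moreover have "(SUP j. ?f j t) \<le> S t"
        unfolding S_def by (rule SUP_mono) (auto simp: indicator_def)
      ultimately show ?thesis using True by (simp add: antisym)
    qed (auto simp: indicator_def)
    have "(\<integral>\<^sup>+t. S t * indicator {0..} t \<partial>lborel) = (SUP j. \<integral>\<^sup>+t. ?f j t \<partial>lborel)"
      unfolding sup
    proof (rule nn_integral_monotone_convergence_SUP)
      show "incseq ?f"
        by (auto simp: incseq_def le_fun_def indicator_def intro: incseqD[OF inc])
    qed measurable
    also have "\<dots> \<le> ennreal ((14 * C * P)\<^sup>2)"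
      unfolding V_def by (intro SUP_least strichartz_linearized m C K P) auto
    finally show ?thesis .
  qed
  ultimately show ?thesis
    unfolding V_def by (intro exI[of _ S] conjI allI) auto
qed

section \<open>Bessel's inequality\<close>

abbreviation energy :: "(real \<Rightarrow> complex) \<Rightarrow> ennreal" where
  "energy f \<equiv> \<integral>\<^sup>+x. ennreal ((norm (f x))\<^sup>2) \<partial>lborel"

text \<open>
  The Gaussian weight makes \<open>T T\<^sup>*\<close> an integral operator whose kernel is a Gaussian of mass \<open>2\<pi>\<close>.
\<close>

lemma bessel_inequality_aux:
  fixes f :: "real \<Rightarrow> complex"
  assumes [measurable]: "f \<in> borel_measurable borel" and int: "integrable lborel f"
    and s: "\<bar>s\<bar> = 1" and \<epsilon>: "\<epsilon> > 0"
  shows "(\<integral>\<^sup>+k. ennreal (exp (- (\<epsilon> * k)\<^sup>2 / 2) * (norm (\<integral>x. iexp (s * k * x) * f x \<partial>lborel))\<^sup>2) \<partial>lborel)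
    \<le> ennreal (2 * pi) * energy f"
proof -
  define A where "A = std_normal_distribution"
  interpret A: real_distribution A unfolding A_def by (rule real_dist_normal_dist)
  have [measurable_cong]: "sets A = sets borel" by (simp add: A_def)
  interpret LA: pair_sigma_finite lborel A ..
  \<comment> \<open>Substituting \<open>k = z / \<epsilon>\<close> turns the Gaussian weight into
    the standard normal law, and the composed kernel into its characteristic function.\<close>
  define e where "e x z = iexp (s * (z / \<epsilon>) * x)" for x z
  have em [measurable]: "(\<lambda>(x, z). e x z) \<in> borel_measurable (lborel \<Otimes>\<^sub>M A)" unfolding e_def by measurable
  define G where "G k = (\<integral>x. iexp (s * k * x) * f x \<partial>lborel)" for k
  have [measurable]: "G \<in> borel_measurable borel" unfolding G_def by measurable
  have ker: "(\<integral>z. e x z * cnj (e y z) \<partial>A) = complex_of_real (exp (- ((x - y) / \<epsilon>)\<^sup>2 / 2))" for x y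
  proof -
    have "e x z * cnj (e y z) = iexp ((s * (x - y) / \<epsilon>) * z)" for z
      by (simp add: e_def exp_cnj exp_add[symmetric] algebra_simps diff_divide_distrib)
    then have "(\<integral>z. e x z * cnj (e y z) \<partial>A) = char A (s * (x - y) / \<epsilon>)"
      by (simp add: char_def)
    also have "\<dots> = complex_of_real (exp (- (s * (x - y) / \<epsilon>)\<^sup>2 / 2))"
      by (simp add: A_def char_std_normal_distribution)
    also have "(s * (x - y) / \<epsilon>)\<^sup>2 = \<bar>s\<bar>\<^sup>2 * ((x - y) / \<epsilon>)\<^sup>2" by (simp add: power_mult_distrib power_divide)
    finally show ?thesis unfolding s by simp
  qed
  define \<rho> where "\<rho> x y = ennreal (exp (- ((x - y) / \<epsilon>)\<^sup>2 / 2))" for x y :: real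
  have [measurable]: "(\<lambda>(x, y). \<rho> x y) \<in> borel_measurable (borel \<Otimes>\<^sub>M borel)" unfolding \<rho>_def by measurable
  have \<rho>sym: "\<rho> x y = \<rho> y x" for x y by (simp add: \<rho>_def power2_commute power_divide)
  have gauss: "(\<integral>\<^sup>+z. ennreal (exp (- z\<^sup>2 / 2)) \<partial>lborel) = ennreal (sqrt (2 * pi))"
  proof -
    have "(\<integral>\<^sup>+z. ennreal (std_normal_density z) \<partial>lborel) = 1"
      using A.emeasure_space_1 unfolding A_def by (subst (asm) emeasure_density) auto
    then have "ennreal (sqrt (2 * pi)) * (\<integral>\<^sup>+z. ennreal (std_normal_density z) \<partial>lborel) = ennreal (sqrt (2 * pi))"
      by simp
    then show ?thesis
      by (subst (asm) nn_integral_cmult[symmetric])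
         (auto simp: std_normal_density_def field_simps simp flip: ennreal_mult)
  qed
  have \<rho>int: "(\<integral>\<^sup>+y. \<rho> x y \<partial>lborel) = ennreal (\<epsilon> * sqrt (2 * pi))" for x
    using nn_integral_real_affine[of "\<lambda>y. \<rho> x y" \<epsilon> x] \<epsilon>
    by (simp add: \<rho>_def gauss[simplified] ennreal_mult)
  have "(\<integral>\<^sup>+z. ennreal ((norm (G (z / \<epsilon>)))\<^sup>2) \<partial>A) \<le>
      (\<integral>\<^sup>+x. \<integral>\<^sup>+y. ennreal (norm (f x) * norm (f y) * norm (\<integral>z. e x z * cnj (e y z) \<partial>A)) \<partial>lborel \<partial>lborel)"
    using LA.TT_star_bound[OF A.finite_measure_axioms em int] by (simp add: e_def G_def)
  \<comment> \<open>Schur's test: after splitting the product of the two norms into squares, one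
    variable of each term meets only the Gaussian.\<close>
  also have "\<dots> \<le> (\<integral>\<^sup>+x. \<integral>\<^sup>+y. ennreal (1/2) * (ennreal ((norm (f x))\<^sup>2) * \<rho> x y + ennreal ((norm (f y))\<^sup>2) * \<rho> y x) \<partial>lborel \<partial>lborel)"
  proof (intro nn_integral_mono)
    fix x y
    have "norm (f x) * norm (f y) \<le> 1/2 * ((norm (f x))\<^sup>2 + (norm (f y))\<^sup>2)"
      using sum_squares_bound[of "norm (f x)" "norm (f y)"] by simp
    then have "norm (f x) * norm (f y) * exp (- ((x - y) / \<epsilon>)\<^sup>2 / 2) \<le> 1/2 * ((norm (f x))\<^sup>2 + (norm (f y))\<^sup>2) * exp (- ((x - y) / \<epsilon>)\<^sup>2 / 2)"
      by (intro mult_right_mono) auto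
    then have "ennreal (norm (f x) * norm (f y) * norm (\<integral>z. e x z * cnj (e y z) \<partial>A)) \<le> ennreal (1/2 * ((norm (f x))\<^sup>2 + (norm (f y))\<^sup>2) * exp (- ((x - y) / \<epsilon>)\<^sup>2 / 2))"
      unfolding ker by (intro ennreal_leI) simp
    also have "\<dots> = ennreal (1/2) * (ennreal ((norm (f x))\<^sup>2) * \<rho> x y + ennreal ((norm (f y))\<^sup>2) * \<rho> x y)"
      unfolding \<rho>_def by (simp only: ennreal_mult ennreal_plus zero_le_power2 norm_ge_zero exp_ge_zero add_nonneg_nonneg
        mult_nonneg_nonneg distrib_right) (simp add: ennreal_mult ennreal_plus algebra_simps)
    finally show "ennreal (norm (f x) * norm (f y) * norm (\<integral>z. e x z * cnj (e y z) \<partial>A)) \<le>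
       ennreal (1/2) * (ennreal ((norm (f x))\<^sup>2) * \<rho> x y + ennreal ((norm (f y))\<^sup>2) * \<rho> y x)"
      using \<rho>sym[of x y] by simp
  qed
  also have "\<dots> = ennreal (1/2) * ((\<integral>\<^sup>+x. \<integral>\<^sup>+y. ennreal ((norm (f x))\<^sup>2) * \<rho> x y \<partial>lborel \<partial>lborel)
     + (\<integral>\<^sup>+x. \<integral>\<^sup>+y. ennreal ((norm (f y))\<^sup>2) * \<rho> y x \<partial>lborel \<partial>lborel))"
    by (simp add: nn_integral_cmult nn_integral_add)
  also have "(\<integral>\<^sup>+x. \<integral>\<^sup>+y. ennreal ((norm (f y))\<^sup>2) * \<rho> y x \<partial>lborel \<partial>lborel) =
      (\<integral>\<^sup>+x. \<integral>\<^sup>+y. ennreal ((norm (f x))\<^sup>2) * \<rho> x y \<partial>lborel \<partial>lborel)"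
    by (rule lborel_pair.Fubini') simp
  also have "(\<integral>\<^sup>+x. \<integral>\<^sup>+y. ennreal ((norm (f x))\<^sup>2) * \<rho> x y \<partial>lborel \<partial>lborel) = energy f * ennreal (\<epsilon> * sqrt (2 * pi))"
    by (simp add: nn_integral_cmult nn_integral_multc \<rho>int)
  also have "ennreal (1/2) * (energy f * ennreal (\<epsilon> * sqrt (2 * pi)) + energy f * ennreal (\<epsilon> * sqrt (2 * pi)))
      = energy f * ennreal (\<epsilon> * sqrt (2 * pi))"
  proof -
    have "ennreal (1/2) * (a + a) = a" for a :: ennreal
    proof -
      have "ennreal (1/2) * (a + a) = (ennreal (1/2) + ennreal (1/2)) * a" by (simp only: distrib_left distrib_right)
      also have "ennreal (1/2) + ennreal (1/2) = ennreal (1/2 + 1/2)" by (rule ennreal_plus[symmetric]) auto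
      also have "\<dots> * a = a" by simp
      finally show ?thesis .
    qed
    then show ?thesis .
  qed
  finally have bound: "(\<integral>\<^sup>+z. ennreal ((norm (G (z / \<epsilon>)))\<^sup>2) \<partial>A) \<le> energy f * ennreal (\<epsilon> * sqrt (2 * pi))" .
  \<comment> \<open>Returning to \<open>k\<close> contributes
    \<open>sqrt (2 * pi) / \<epsilon>\<close>. Together with the Gaussian mass
    \<open>\<epsilon> * sqrt (2 * pi)\<close> this leaves \<open>2 * pi\<close>, independent of
    \<open>\<epsilon>\<close>.\<close>
  have "(\<integral>\<^sup>+k. ennreal (exp (- (\<epsilon> * k)\<^sup>2 / 2) * (norm (G k))\<^sup>2) \<partial>lborel)
      = ennreal (1 / \<epsilon>) * (\<integral>\<^sup>+z. ennreal (exp (- z\<^sup>2 / 2) * (norm (G (z / \<epsilon>)))\<^sup>2) \<partial>lborel)"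
    using nn_integral_real_affine[of "\<lambda>k. ennreal (exp (- (\<epsilon> * k)\<^sup>2 / 2) * (norm (G k))\<^sup>2)" "1 / \<epsilon>" 0] \<epsilon>
    by simp
  also have "(\<integral>\<^sup>+z. ennreal (exp (- z\<^sup>2 / 2) * (norm (G (z / \<epsilon>)))\<^sup>2) \<partial>lborel)
      = ennreal (sqrt (2 * pi)) * (\<integral>\<^sup>+z. ennreal ((norm (G (z / \<epsilon>)))\<^sup>2) \<partial>A)"
    unfolding A_def
    by (subst nn_integral_density, simp, simp, subst nn_integral_cmult[symmetric], simp)
       (auto simp: std_normal_density_def field_simps simp flip: ennreal_mult intro!: nn_integral_cong)
  also have "ennreal (1 / \<epsilon>) * (ennreal (sqrt (2 * pi)) * (\<integral>\<^sup>+z. ennreal ((norm (G (z / \<epsilon>)))\<^sup>2) \<partial>A))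
    \<le> ennreal (1 / \<epsilon>) * (ennreal (sqrt (2 * pi)) * (energy f * ennreal (\<epsilon> * sqrt (2 * pi))))"
    by (intro mult_left_mono bound) auto
  also have "\<dots> = ennreal (1 / \<epsilon>) * ennreal (sqrt (2 * pi)) * ennreal (\<epsilon> * sqrt (2 * pi)) * energy f"
    by (simp only: mult_ac)
  also have "ennreal (1 / \<epsilon>) * ennreal (sqrt (2 * pi)) * ennreal (\<epsilon> * sqrt (2 * pi)) =
      ennreal (1 / \<epsilon> * sqrt (2 * pi) * (\<epsilon> * sqrt (2 * pi)))"
    using \<epsilon> by (simp only: ennreal_mult mult_nonneg_nonneg divide_nonneg_nonneg real_sqrt_ge_zero pi_ge_zero less_imp_le zero_le_numeral zero_le_one)
  also have "1 / \<epsilon> * sqrt (2 * pi) * (\<epsilon> * sqrt (2 * pi)) = 2 * pi"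
    using \<epsilon> by (simp add: field_simps)
  finally show ?thesis unfolding G_def .
qed

text \<open>The weighted bound is uniform in \<open>\<epsilon>\<close>, so Fatou's lemma along
  \<open>\<epsilon> = 1 / Suc j\<close> removes the weight. The sign \<open>s = -1\<close> gives the
  Fourier transform and \<open>s = 1\<close> gives \<open>2 * pi\<close> times its inverse.\<close>

lemma bessel_inequality:
  fixes f :: "real \<Rightarrow> complex"
  assumes f [measurable]: "f \<in> borel_measurable borel" and int: "integrable lborel f"
    and s: "\<bar>s\<bar> = 1"
  shows "energy (\<lambda>k. \<integral>x. iexp (s * k * x) * f x \<partial>lborel) \<le> ennreal (2 * pi) * energy f"
proof -
  define G where "G k = (\<integral>x. iexp (s * k * x) * f x \<partial>lborel)" for k
  have [measurable]: "G \<in> borel_measurable borel" unfolding G_def by measurable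
  let ?h = "\<lambda>j k. exp (- (1 / real (Suc j) * k)\<^sup>2 / 2) * (norm (G k))\<^sup>2"
  have "(\<lambda>j. ennreal (?h j k)) \<longlonglongrightarrow> ennreal ((norm (G k))\<^sup>2)" for k
  proof (rule tendsto_ennrealI)
    have "(\<lambda>j. 1 / real (Suc j)) \<longlonglongrightarrow> 0" using LIMSEQ_inverse_real_of_nat by (simp add: field_simps)
    then have "(\<lambda>j. ?h j k) \<longlonglongrightarrow> exp (- (0 * k)\<^sup>2 / 2) * (norm (G k))\<^sup>2"
      by (intro tendsto_intros) auto
    then show "(\<lambda>j. ?h j k) \<longlonglongrightarrow> (norm (G k))\<^sup>2" by simp
  qed
  then have lim: "ennreal ((norm (G k))\<^sup>2) = liminf (\<lambda>j. ennreal (?h j k))" for k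
    by (rule lim_imp_Liminf[symmetric, rotated]) simp
  have "energy G = (\<integral>\<^sup>+k. liminf (\<lambda>j. ennreal (?h j k)) \<partial>lborel)" by (simp only: lim[symmetric])
  also have "\<dots> \<le> liminf (\<lambda>j. \<integral>\<^sup>+k. ennreal (?h j k) \<partial>lborel)" by (rule nn_integral_liminf) measurable
  also have "\<dots> \<le> liminf (\<lambda>j. ennreal (2 * pi) * energy f)"
    unfolding G_def by (intro Liminf_mono always_eventually allI bessel_inequality_aux f int s) auto
  also have "\<dots> = ennreal (2 * pi) * energy f" by (simp add: Liminf_const)
  finally show ?thesis unfolding G_def .
qed

section \<open>\<open>L\<^sup>2\<close> limits of truncated Fourier integrals\<close>

definition tail_energy :: "(real \<Rightarrow> complex) \<Rightarrow> real \<Rightarrow> ennreal" where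
  "tail_energy f R = (\<integral>\<^sup>+x. ennreal ((norm (f x))\<^sup>2) * indicator (- {-R..R}) x \<partial>lborel)"

lemma tail_energy_antimono: "R \<le> R' \<Longrightarrow> tail_energy f R' \<le> tail_energy f R"
  unfolding tail_energy_def by (intro nn_integral_mono) (auto simp: indicator_def)

lemma tail_energy_tendsto_0:
  assumes [measurable]: "f \<in> borel_measurable borel" and f: "energy f < \<infinity>"
  shows "(tail_energy f \<longlongrightarrow> 0) at_top"
proof -
  have "(\<lambda>j. \<integral>\<^sup>+x. ennreal ((norm (f x))\<^sup>2) * indicator (- {-real j..real j}) x \<partial>lborel) \<longlonglongrightarrow> (\<integral>\<^sup>+x. 0 \<partial>(lborel :: real measure))"
  proof (rule nn_integral_dominated_convergence[where w="\<lambda>x. ennreal ((norm (f x))\<^sup>2)"])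
    show "AE x in lborel. (\<lambda>j. ennreal ((norm (f x))\<^sup>2) * indicator (- {-real j..real j}) x) \<longlonglongrightarrow> 0"
    proof (rule AE_I2)
      fix x :: real
      obtain N :: nat where "\<bar>x\<bar> \<le> real N" using real_arch_simple by blast
      then have "eventually (\<lambda>j. ennreal ((norm (f x))\<^sup>2) * indicator (- {-real j..real j}) x = 0) sequentially"
        by (intro eventually_sequentiallyI[of N]) (auto simp: indicator_def)
      then show "(\<lambda>j. ennreal ((norm (f x))\<^sup>2) * indicator (- {-real j..real j}) x) \<longlonglongrightarrow> 0"
        by (rule tendsto_eventually)
    qed
  qed (use f in \<open>auto simp: indicator_def\<close>)
  then have lim: "(\<lambda>j. tail_energy f (real j)) \<longlonglongrightarrow> 0" by (simp add: tail_energy_def)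
  show ?thesis
  proof (rule order_tendstoI)
    fix a :: ennreal assume "0 < a"
    then obtain j where j: "tail_energy f (real j) < a"
      using order_tendstoD(2)[OF lim] by (metis eventually_sequentially order_refl)
    show "eventually (\<lambda>R. tail_energy f R < a) at_top"
      using eventually_ge_at_top[of "real j"]
      by eventually_elim (use j tail_energy_antimono in \<open>blast intro: le_less_trans\<close>)
  qed simp
qed

text \<open>
  Along such radii the truncated transforms converge almost everywhere. Since \<open>tail_energy\<close> only sees
  \<open>norm \<circ> f\<close>, one sequence serves the propagated data at all times, so that the limit is jointly
  measurable in time and space.
\<close>

definition fast_radii :: "(real \<Rightarrow> complex) \<Rightarrow> (nat \<Rightarrow> real) \<Rightarrow> bool" where
  "fast_radii f n \<longleftrightarrow> (\<forall>j. real j < n j \<and> tail_energy f (n j) \<le> ennreal ((1/8) ^ j))"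

lemma fast_radii_exists:
  assumes "f \<in> borel_measurable borel" "energy f < \<infinity>"
  shows "\<exists>n. fast_radii f n"
  unfolding fast_radii_def
proof (rule choice, rule allI)
  fix j :: nat
  have "eventually (\<lambda>R. tail_energy f R < ennreal ((1/8) ^ j)) at_top"
    by (rule order_tendstoD(2)[OF tail_energy_tendsto_0[OF assms]]) simp
  then have "eventually (\<lambda>R. real j < R \<and> tail_energy f R < ennreal ((1/8) ^ j)) at_top"
    using eventually_gt_at_top[of "real j"] by eventually_elim auto
  then show "\<exists>R. real j < R \<and> tail_energy f R \<le> ennreal ((1/8) ^ j)"
    by (auto simp: eventually_at_top_linorder intro: less_imp_le)
qed

lemma fast_radii_eventually_ge:
  assumes "fast_radii f n"
  shows "eventually (\<lambda>j. R \<le> n j) sequentially"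
proof -
  obtain N :: nat where "R \<le> real N" using real_arch_simple by blast
  moreover have "real j < n j" for j using assms by (auto simp: fast_radii_def)
  ultimately show ?thesis
    by (intro eventually_sequentiallyI[of N]) (smt (verit) of_nat_mono)
qed

definition truncated_fourier :: "real \<Rightarrow> real \<Rightarrow> (real \<Rightarrow> complex) \<Rightarrow> real \<Rightarrow> complex" where
  "truncated_fourier s R f k = (CLINT x:{-R..R}|lborel. iexp (s * k * x) * f x)"

lemma borel_measurable_truncated_fourier [measurable]:
  assumes [measurable]: "f \<in> borel_measurable borel"
  shows "truncated_fourier s R f \<in> borel_measurable borel"
  unfolding truncated_fourier_def[abs_def] set_lebesgue_integral_def by measurable

lemma truncated_fourier_energy:
  assumes f [measurable]: "f \<in> borel_measurable borel" and e: "energy f < \<infinity>" and s: "\<bar>s\<bar> = 1"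
  shows "energy (truncated_fourier s R f) \<le> ennreal (2 * pi) * energy f"
proof -
  have "energy (\<lambda>k. \<integral>x. iexp (s * k * x) * (indicator {-R..R} x *\<^sub>R f x) \<partial>lborel)
      \<le> ennreal (2 * pi) * energy (\<lambda>x. indicator {-R..R} x *\<^sub>R f x)"
    by (intro bessel_inequality truncation_integrable e s f) auto
  also have "\<dots> \<le> ennreal (2 * pi) * energy f"
    by (intro mult_left_mono nn_integral_mono) (auto simp: indicator_def)
  finally show ?thesis
    by (simp add: truncated_fourier_def set_lebesgue_integral_def)
qed

text \<open>Bessel's inequality for the part of \<open>f\<close> living on
  \<open>R < |x| <= R'\<close>. This makes the truncated transforms a Cauchy family in
  \<open>L^2\<close>.\<close>

lemma truncated_fourier_diff_energy:
  assumes f [measurable]: "f \<in> borel_measurable borel" and e: "energy f < \<infinity>" and s: "\<bar>s\<bar> = 1"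
    and R: "R \<le> R'"
  shows "energy (\<lambda>k. truncated_fourier s R' f k - truncated_fourier s R f k) \<le> ennreal (2 * pi) * tail_energy f R"
proof -
  define g where "g x = indicator {-R'..R'} x *\<^sub>R f x - indicator {-R..R} x *\<^sub>R f x" for x
  have [measurable]: "g \<in> borel_measurable borel" unfolding g_def by measurable
  have int: "integrable lborel (\<lambda>x. indicator {-S..S} x *\<^sub>R f x)" for S
    by (intro truncation_integrable e f) auto
  have int': "integrable lborel (\<lambda>x. indicator {-S..S} x *\<^sub>R (iexp (s * k * x) * f x))" for S k
    by (rule Bochner_Integration.integrable_bound[OF int[of S]]) (auto simp: norm_mult)
  have "truncated_fourier s R' f k - truncated_fourier s R f k = (\<integral>x. iexp (s * k * x) * g x \<partial>lborel)" for k
    unfolding truncated_fourier_def set_lebesgue_integral_def g_def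
    by (subst Bochner_Integration.integral_diff[symmetric], rule int', rule int', rule Bochner_Integration.integral_cong)
       (auto simp: algebra_simps)
  then have "energy (\<lambda>k. truncated_fourier s R' f k - truncated_fourier s R f k)
      = energy (\<lambda>k. \<integral>x. iexp (s * k * x) * g x \<partial>lborel)" by simp
  also have "\<dots> \<le> ennreal (2 * pi) * energy g"
    by (rule bessel_inequality) (use int in \<open>auto simp: g_def s\<close>)
  also have "energy g \<le> tail_energy f R"
    unfolding tail_energy_def using R
    by (intro nn_integral_mono) (auto simp: g_def indicator_def)
  finally show ?thesis by (simp add: mult_left_mono)
qed

text \<open>Weighting the squared increments by \<open>4 ^ j\<close> still leaves integrals summable
  like \<open>(1/2) ^ j\<close>, so the weighted series is finite almost everywhere. There the
  increments are at most \<open>sqrt B * (1/2) ^ j\<close> and hence summable. The rate 1/8 leaves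
  room for both geometric series.\<close>

lemma AE_convergent_of_energy_summable:
  fixes h :: "nat \<Rightarrow> real \<Rightarrow> complex"
  assumes [measurable]: "\<And>j. h j \<in> borel_measurable borel"
    and c: "c \<ge> 0" and e: "\<And>j. energy (\<lambda>x. h (Suc j) x - h j x) \<le> ennreal (c * (1/8) ^ j)"
  shows "AE x in lborel. convergent (\<lambda>j. h j x)"
proof -
  define d where "d j x = (norm (h (Suc j) x - h j x))\<^sup>2" for j x
  have [measurable]: "d j \<in> borel_measurable borel" for j unfolding d_def by measurable
  have "(\<integral>\<^sup>+x. (\<Sum>j. ennreal (4 ^ j) * ennreal (d j x)) \<partial>lborel) = (\<Sum>j. \<integral>\<^sup>+x. ennreal (4 ^ j) * ennreal (d j x) \<partial>lborel)"
    by (rule nn_integral_suminf) measurable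
  also have "\<dots> = (\<Sum>j. ennreal (4 ^ j) * energy (\<lambda>x. h (Suc j) x - h j x))"
    by (simp add: nn_integral_cmult d_def)
  also have "\<dots> \<le> (\<Sum>j. ennreal (c * (1/2) ^ j))"
  proof (intro suminf_le)
    fix j
    have "ennreal (4 ^ j) * energy (\<lambda>x. h (Suc j) x - h j x) \<le> ennreal (4 ^ j) * ennreal (c * (1/8) ^ j)"
      by (intro mult_left_mono e) auto
    also have "\<dots> = ennreal (c * (4 * (1/8)) ^ j)"
      using c by (simp only: power_mult_distrib) (simp flip: ennreal_mult add: mult_ac)
    finally show "ennreal (4 ^ j) * energy (\<lambda>x. h (Suc j) x - h j x) \<le> ennreal (c * (1/2) ^ j)" by simp
  qed auto
  also have "\<dots> = ennreal (\<Sum>j. c * (1/2) ^ j)"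
    using c by (intro suminf_ennreal2 summable_mult summable_geometric) auto
  also have "\<dots> < \<infinity>" by simp
  finally have "AE x in lborel. (\<Sum>j. ennreal (4 ^ j) * ennreal (d j x)) \<noteq> \<infinity>"
    by (intro nn_integral_noteq_infinite) auto
  then show ?thesis
  proof eventually_elim
    fix x
    assume "(\<Sum>j. ennreal (4 ^ j) * ennreal (d j x)) \<noteq> \<infinity>"
    then obtain B where B: "(\<Sum>j. ennreal (4 ^ j) * ennreal (d j x)) = ennreal B" "B \<ge> 0"
      by (metis ennreal_cases infinity_ennreal_def)
    have le: "norm (h (Suc j) x - h j x) \<le> sqrt B * (1/2) ^ j" for j
    proof -
      have "ennreal (4 ^ j * d j x) = (\<Sum>i\<in>{j}. ennreal (4 ^ i) * ennreal (d i x))"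
        by (simp add: d_def ennreal_mult)
      also have "\<dots> \<le> ennreal B" unfolding B(1)[symmetric] by (rule sum_le_suminf) auto
      finally have "(2 ^ j * norm (h (Suc j) x - h j x))\<^sup>2 \<le> B"
        using B(2) by (simp add: d_def power_mult_distrib power_mult[symmetric] mult.commute[of _ 2]) (simp add: power_mult)
      then have "2 ^ j * norm (h (Suc j) x - h j x) \<le> sqrt B" by (rule real_le_rsqrt)
      then show ?thesis by (simp add: field_simps power_one_over)
    qed
    have "summable (\<lambda>j. h (Suc j) x - h j x)"
      by (rule summable_comparison_test'[where N=0 and g="\<lambda>j. sqrt B * (1/2) ^ j"])
         (use le in \<open>auto intro!: summable_mult summable_geometric\<close>)
    then have "convergent (\<lambda>j. h j x - h 0 x)"
      using sum_lessThan_telescope[of "\<lambda>i. h i x"] by (simp add: summable_iff_convergent)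
    from convergent_add[OF this convergent_const[of "h 0 x"]] show "convergent (\<lambda>j. h j x)"
      by simp
  qed
qed

text \<open>A pointwise limit instead of a chosen \<open>L^2\<close> limit: it is an explicit Borel
  function. At points of divergence \<open>lim\<close> has an unspecified value, which for fast
  radii happens only on a null set.\<close>

definition fourier_limit :: "real \<Rightarrow> (nat \<Rightarrow> real) \<Rightarrow> (real \<Rightarrow> complex) \<Rightarrow> real \<Rightarrow> complex" where
  "fourier_limit s n f k = lim (\<lambda>j. truncated_fourier s (n j) f k)"

section \<open>Existence and uniqueness of the \<open>L^2\<close> limit\<close>

context
  fixes f :: "real \<Rightarrow> complex" and s :: real and n :: "nat \<Rightarrow> real"
  assumes f [measurable]: "f \<in> borel_measurable borel" and e: "energy f < \<infinity>" and s: "\<bar>s\<bar> = 1"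
    and n: "fast_radii f n"
begin

lemma borel_measurable_fourier_limit [measurable]: "fourier_limit s n f \<in> borel_measurable borel"
  unfolding fourier_limit_def[abs_def] by measurable

lemma AE_fourier_limit:
  "AE k in lborel. (\<lambda>j. truncated_fourier s (n j) f k) \<longlonglongrightarrow> fourier_limit s n f k"
proof -
  have tail: "tail_energy f (n j) \<le> ennreal ((1/8) ^ j)" for j using n by (auto simp: fast_radii_def)
  have "AE k in lborel. convergent (\<lambda>j. truncated_fourier s (n j) f k)"
  proof (rule AE_convergent_of_energy_summable[where c="2 * pi"])
    fix j
    have "energy (\<lambda>k. truncated_fourier s (n (Suc j)) f k - truncated_fourier s (n j) f k) \<le> ennreal (2 * pi) * ennreal ((1/8) ^ j)"
    \<comment> \<open>Fast radii need not increase. In the other order the tail beyond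
      \<open>n (Suc j)\<close> is even smaller than required.\<close>
    proof (cases "n j \<le> n (Suc j)")
      case True
      show ?thesis
        by (rule order_trans[OF truncated_fourier_diff_energy[OF f e s True]]) (intro mult_left_mono tail, simp)
    next
      case False
      have "energy (\<lambda>k. truncated_fourier s (n (Suc j)) f k - truncated_fourier s (n j) f k)
          = energy (\<lambda>k. truncated_fourier s (n j) f k - truncated_fourier s (n (Suc j)) f k)"
        by (simp add: norm_minus_commute)
      also have "\<dots> \<le> ennreal (2 * pi) * tail_energy f (n (Suc j))"
        using False by (intro truncated_fourier_diff_energy f e s) auto
      also have "\<dots> \<le> ennreal (2 * pi) * ennreal ((1/8) ^ j)"
        by (intro mult_left_mono order_trans[OF tail] ennreal_leI) auto
      finally show ?thesis .
    qed
    then show "energy (\<lambda>k. truncated_fourier s (n (Suc j)) f k - truncated_fourier s (n j) f k) \<le> ennreal (2 * pi * (1/8) ^ j)"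
      by (simp add: ennreal_mult)
  qed auto
  then show ?thesis
    by eventually_elim (simp add: fourier_limit_def convergent_LIMSEQ_iff)
qed

text \<open>Fatou's lemma along the radii: eventually \<open>n j\<close> exceeds \<open>R\<close>,
  and from then on the tail beyond \<open>R\<close> bounds the difference.\<close>

lemma fourier_limit_diff_energy:
  "energy (\<lambda>k. fourier_limit s n f k - truncated_fourier s R f k) \<le> ennreal (2 * pi) * tail_energy f R"
proof -
  have "energy (\<lambda>k. fourier_limit s n f k - truncated_fourier s R f k) =
    (\<integral>\<^sup>+k. liminf (\<lambda>j. ennreal ((norm (truncated_fourier s (n j) f k - truncated_fourier s R f k))\<^sup>2)) \<partial>lborel)"
  proof (rule nn_integral_cong_AE, use AE_fourier_limit in eventually_elim)
    fix k assume "(\<lambda>j. truncated_fourier s (n j) f k) \<longlonglongrightarrow> fourier_limit s n f k"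
    then have "(\<lambda>j. ennreal ((norm (truncated_fourier s (n j) f k - truncated_fourier s R f k))\<^sup>2))
       \<longlonglongrightarrow> ennreal ((norm (fourier_limit s n f k - truncated_fourier s R f k))\<^sup>2)"
      by (intro tendsto_ennrealI tendsto_intros)
    then show "ennreal ((norm (fourier_limit s n f k - truncated_fourier s R f k))\<^sup>2) =
       liminf (\<lambda>j. ennreal ((norm (truncated_fourier s (n j) f k - truncated_fourier s R f k))\<^sup>2))"
      by (rule lim_imp_Liminf[symmetric, rotated]) simp
  qed
  also have "\<dots> \<le> liminf (\<lambda>j. energy (\<lambda>k. truncated_fourier s (n j) f k - truncated_fourier s R f k))"
    by (rule nn_integral_liminf) measurable
  also have "\<dots> \<le> liminf (\<lambda>j. ennreal (2 * pi) * tail_energy f R)"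
    by (intro Liminf_mono eventually_mono[OF fast_radii_eventually_ge[OF n, of R]] truncated_fourier_diff_energy f e s)
  also have "\<dots> = ennreal (2 * pi) * tail_energy f R" by (simp add: Liminf_const)
  finally show ?thesis .
qed

lemma fourier_limit_energy: "energy (fourier_limit s n f) \<le> ennreal (2 * pi) * energy f"
proof -
  have "energy (fourier_limit s n f) =
    (\<integral>\<^sup>+k. liminf (\<lambda>j. ennreal ((norm (truncated_fourier s (n j) f k))\<^sup>2)) \<partial>lborel)"
  proof (rule nn_integral_cong_AE, use AE_fourier_limit in eventually_elim)
    fix k assume "(\<lambda>j. truncated_fourier s (n j) f k) \<longlonglongrightarrow> fourier_limit s n f k"
    then have "(\<lambda>j. ennreal ((norm (truncated_fourier s (n j) f k))\<^sup>2)) \<longlonglongrightarrow> ennreal ((norm (fourier_limit s n f k))\<^sup>2)"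
      by (intro tendsto_ennrealI tendsto_intros)
    then show "ennreal ((norm (fourier_limit s n f k))\<^sup>2) = liminf (\<lambda>j. ennreal ((norm (truncated_fourier s (n j) f k))\<^sup>2))"
      by (rule lim_imp_Liminf[symmetric, rotated]) simp
  qed
  also have "\<dots> \<le> liminf (\<lambda>j. energy (truncated_fourier s (n j) f))"
    by (rule nn_integral_liminf) measurable
  also have "\<dots> \<le> liminf (\<lambda>j. ennreal (2 * pi) * energy f)"
    by (intro Liminf_mono always_eventually allI truncated_fourier_energy f e s)
  also have "\<dots> = ennreal (2 * pi) * energy f" by (simp add: Liminf_const)
  finally show ?thesis .
qed

lemma fourier_limit_tendsto:
  "((\<lambda>R. energy (\<lambda>k. fourier_limit s n f k - truncated_fourier s R f k)) \<longlongrightarrow> 0) at_top"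
proof (rule tendsto_sandwich[of "\<lambda>_. 0" _ _ "\<lambda>R. ennreal (2 * pi) * tail_energy f R"])
  show "((\<lambda>R. ennreal (2 * pi) * tail_energy f R) \<longlongrightarrow> 0) at_top"
    using ennreal_tendsto_cmult[OF _ tail_energy_tendsto_0[OF f e], of "ennreal (2 * pi)"] by simp
qed (auto intro!: always_eventually fourier_limit_diff_energy)

text \<open>Both functions are compared with the same truncation through
  \<open>(a + b)^2 <= 2 a^2 + 2 b^2\<close>, and \<open>R\<close> tends to infinity. This identifies
  whatever \<open>SOME\<close> selects in the definitions with the explicit limit.\<close>

lemma fourier_limit_unique:
  assumes [measurable]: "g \<in> borel_measurable borel"
    and g: "((\<lambda>R. energy (\<lambda>k. g k - truncated_fourier s R f k)) \<longlongrightarrow> 0) at_top"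
  shows "AE k in lborel. g k = fourier_limit s n f k"
proof -
  let ?U = "fourier_limit s n f" and ?T = "\<lambda>R. truncated_fourier s R f"
  have "energy (\<lambda>k. g k - ?U k) \<le> 2 * energy (\<lambda>k. g k - ?T R k) + 2 * energy (\<lambda>k. ?U k - ?T R k)" for R
  proof -
    have "energy (\<lambda>k. g k - ?U k) \<le> (\<integral>\<^sup>+k. 2 * ennreal ((norm (g k - ?T R k))\<^sup>2) + 2 * ennreal ((norm (?U k - ?T R k))\<^sup>2) \<partial>lborel)"
    proof (rule nn_integral_mono)
      fix k
      have "norm (g k - ?U k) \<le> norm (g k - ?T R k) + norm (?U k - ?T R k)"
        using norm_triangle_ineq4[of "g k - ?T R k" "?U k - ?T R k"] by simp
      then have "(norm (g k - ?U k))\<^sup>2 \<le> (norm (g k - ?T R k) + norm (?U k - ?T R k))\<^sup>2"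
        by (intro power_mono) auto
      also have "\<dots> \<le> 2 * (norm (g k - ?T R k))\<^sup>2 + 2 * (norm (?U k - ?T R k))\<^sup>2"
        using zero_le_power2[of "norm (g k - ?T R k) - norm (?U k - ?T R k)"]
        by (simp add: power2_sum power2_diff)
      finally have "ennreal ((norm (g k - ?U k))\<^sup>2) \<le> ennreal (2 * (norm (g k - ?T R k))\<^sup>2 + 2 * (norm (?U k - ?T R k))\<^sup>2)"
        by (rule ennreal_leI)
      then show "ennreal ((norm (g k - ?U k))\<^sup>2) \<le> 2 * ennreal ((norm (g k - ?T R k))\<^sup>2) + 2 * ennreal ((norm (?U k - ?T R k))\<^sup>2)"
        by (simp add: ennreal_mult)
    qed
    then show ?thesis by (simp add: nn_integral_add nn_integral_cmult)
  qed
  moreover have "((\<lambda>R. 2 * energy (\<lambda>k. g k - ?T R k) + 2 * energy (\<lambda>k. ?U k - ?T R k)) \<longlongrightarrow> 2 * 0 + 2 * 0) at_top"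
    by (intro tendsto_add ennreal_tendsto_cmult g fourier_limit_tendsto) auto
  ultimately have "energy (\<lambda>k. g k - ?U k) \<le> 0"
    using tendsto_lowerbound[of "\<lambda>R. 2 * energy (\<lambda>k. g k - ?T R k) + 2 * energy (\<lambda>k. ?U k - ?T R k)" 0 at_top "energy (\<lambda>k. g k - ?U k)"]
    by (simp add: eventually_at_top_linorder)
  then have "energy (\<lambda>k. g k - ?U k) = 0" by simp
  then have "AE k in lborel. ennreal ((norm (g k - ?U k))\<^sup>2) = 0"
    by (subst (asm) nn_integral_0_iff_AE) auto
  then show ?thesis by eventually_elim (simp add: ennreal_eq_0_iff)
qed

end

section \<open>Norms and the transforms of the definitions\<close>

lemma enn_powr_ennreal: "r \<ge> 0 \<Longrightarrow> enn_powr (ennreal r) a = ennreal (r powr a)"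
  by (simp add: enn_powr_def)

lemma enn_powr_mono: "0 \<le> a \<Longrightarrow> x \<le> y \<Longrightarrow> enn_powr x a \<le> enn_powr y a"
  by (cases x; cases y) (auto simp: enn_powr_def intro!: ennreal_leI powr_mono2 dest: leD top.not_eq_extremum[THEN iffD1])

lemma borel_measurable_enn_powr [measurable (raw)]:
  fixes a :: real
  assumes [measurable]: "f \<in> borel_measurable M"
  shows "(\<lambda>x. enn_powr (f x) a) \<in> borel_measurable M"
proof -
  have "f -` {\<infinity>} \<inter> space M \<in> sets M" by (rule measurable_sets[OF assms]) auto
  moreover have "{x \<in> space M. f x = \<infinity>} = f -` {\<infinity>} \<inter> space M" by auto
  ultimately show ?thesis
    unfolding enn_powr_def by (intro measurable_If) auto
qed

lemma enn_powr_half_less: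
  assumes "e > 0"
  shows "enn_powr x (1/2) < ennreal e \<longleftrightarrow> x < ennreal (e\<^sup>2)"
proof (cases x)
  case (real r)
  have "sqrt r < e \<longleftrightarrow> r < e\<^sup>2" using assms real by (metis real_sqrt_less_iff real_sqrt_abs abs_of_pos)
  then show ?thesis using real assms by (simp add: enn_powr_ennreal powr_half_sqrt ennreal_less_iff)
qed (simp add: enn_powr_def)

text \<open>Translates the \<open>L^2\<close> limits in the definitions of the transforms, stated
  with norms, into limits of energies.\<close>

lemma enn_powr_half_tendsto_0_iff:
  "((\<lambda>x. enn_powr (f x) (1/2)) \<longlongrightarrow> 0) F \<longleftrightarrow> (f \<longlongrightarrow> 0) F"
proof
  assume L: "((\<lambda>x. enn_powr (f x) (1/2)) \<longlongrightarrow> 0) F"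
  show "(f \<longlongrightarrow> 0) F"
  proof (rule order_tendstoI)
    fix a :: ennreal assume "0 < a"
    then obtain b where b: "0 < b" "ennreal b < a"
      by (metis dense ennreal_cases ennreal_less_zero_iff infinity_ennreal_def not_less top_greatest)
    have "eventually (\<lambda>x. enn_powr (f x) (1/2) < ennreal (sqrt b)) F"
      by (rule order_tendstoD(2)[OF L]) (use b in simp)
    then show "eventually (\<lambda>x. f x < a) F"
      by eventually_elim (use b in \<open>simp add: enn_powr_half_less\<close>)
  qed simp
next
  assume L: "(f \<longlongrightarrow> 0) F"
  show "((\<lambda>x. enn_powr (f x) (1/2)) \<longlongrightarrow> 0) F"
  proof (rule order_tendstoI)
    fix a :: ennreal assume "0 < a"
    then obtain b where b: "0 < b" "ennreal b < a"
      by (metis dense ennreal_cases ennreal_less_zero_iff infinity_ennreal_def not_less top_greatest)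
    have "eventually (\<lambda>x. f x < ennreal (b\<^sup>2)) F"
      by (rule order_tendstoD(2)[OF L]) (use b in simp)
    then show "eventually (\<lambda>x. enn_powr (f x) (1/2) < a) F"
      by eventually_elim (use b in \<open>auto simp flip: enn_powr_half_less intro: less_trans\<close>)
  qed simp
qed

lemma Lp_norm_2: "f \<in> borel_measurable borel \<Longrightarrow> Lp_norm 2 f = enn_powr (energy f) (1/2)"
  by (simp add: Lp_norm_def eLp_norm_def enn_powr_ennreal)

lemma L2_iff: "f \<in> L2 \<longleftrightarrow> f \<in> borel_measurable borel \<and> energy f < \<infinity>"
  by (auto simp: L2_def Lp_norm_2 enn_powr_def less_top[symmetric] split: if_splits)

text \<open>The explicit limit witnesses that the choice in \<open>fourier_L2\<close> is not empty;
  by uniqueness the chosen function agrees with it almost everywhere and inherits its energy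
  bound.\<close>

lemma fourier_L2_properties:
  assumes "f \<in> L2"
  shows "fourier_L2 f \<in> L2" "energy (fourier_L2 f) \<le> ennreal (2 * pi) * energy f"
proof -
  have f [measurable]: "f \<in> borel_measurable borel" and e: "energy f < \<infinity>"
    using assms by (auto simp: L2_iff)
  have s: "\<bar>-1::real\<bar> = 1" by simp
  obtain n where n: "fast_radii f n" using fast_radii_exists[OF f e] by blast
  let ?U = "fourier_limit (-1) n f"
  have eq: "(CLINT x:{-R..R}|lborel. exp (- \<i> * k * x) * f x) = truncated_fourier (-1) R f k" for R k
    by (simp add: truncated_fourier_def mult_ac)
  have "?U \<in> L2"
    unfolding L2_iff using le_less_trans[OF fourier_limit_energy[OF f e s n]] e
    by (auto simp: ennreal_mult_less_top f e s n intro!: borel_measurable_fourier_limit)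
  moreover have "((\<lambda>R. Lp_norm 2 (\<lambda>k. ?U k - (CLINT x:{-R..R}|lborel. exp (- \<i> * k * x) * f x))) \<longlongrightarrow> 0) at_top"
    unfolding eq using fourier_limit_tendsto[OF f e s n]
    by (subst Lp_norm_2) (use e in \<open>auto simp: enn_powr_half_tendsto_0_iff f s n intro!: borel_measurable_diff borel_measurable_fourier_limit\<close>)
  ultimately have "\<exists>g. g \<in> L2 \<and>
     ((\<lambda>R. Lp_norm 2 (\<lambda>k. g k - (CLINT x:{-R..R}|lborel. exp (- \<i> * k * x) * f x))) \<longlongrightarrow> 0) at_top"
    by blast
  from someI_ex[OF this, folded fourier_L2_def]
  have mem: "fourier_L2 f \<in> L2" and lim: "((\<lambda>R. Lp_norm 2 (\<lambda>k. fourier_L2 f k - truncated_fourier (-1) R f k)) \<longlongrightarrow> 0) at_top"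
    unfolding eq by auto
  show "fourier_L2 f \<in> L2" by fact
  have [measurable]: "fourier_L2 f \<in> borel_measurable borel" using mem by (simp add: L2_iff)
  have "AE k in lborel. fourier_L2 f k = ?U k"
    using lim by (intro fourier_limit_unique[OF f e s n]) (auto simp: Lp_norm_2 enn_powr_half_tendsto_0_iff)
  then have "energy (fourier_L2 f) = energy ?U"
    by (intro nn_integral_cong_AE) auto
  then show "energy (fourier_L2 f) \<le> ennreal (2 * pi) * energy f"
    using fourier_limit_energy[OF f e s n] by simp
qed

lemma inverse_fourier_L2_properties:
  assumes g [measurable]: "g \<in> borel_measurable borel" and e: "energy g < \<infinity>" and n: "fast_radii g n"
  shows "inverse_fourier_L2 g \<in> L2"
    "AE x in lborel. inverse_fourier_L2 g x = 1 / (2 * pi) * fourier_limit 1 n g x"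
proof -
  have s: "\<bar>1::real\<bar> = 1" by simp
  let ?U = "fourier_limit 1 n g"
  have U [measurable]: "?U \<in> borel_measurable borel" by (rule borel_measurable_fourier_limit[OF g e s n])
  have eq: "(CLINT k:{-R..R}|lborel. exp (\<i> * k * x) * g k) = truncated_fourier 1 R g x" for R x
    by (simp add: truncated_fourier_def mult_ac)
  have scale: "energy (\<lambda>x. 1 / (2 * pi) * h x) = ennreal (1 / (2 * pi)\<^sup>2) * energy h"
    if "h \<in> borel_measurable borel" for h :: "real \<Rightarrow> complex"
    using that by (subst nn_integral_cmult[symmetric])
      (auto simp: norm_mult norm_divide power_mult_distrib power_divide simp flip: ennreal_mult intro!: nn_integral_cong)
  have "energy ?U < \<infinity>"
    using le_less_trans[OF fourier_limit_energy[OF g e s n]] e by (auto simp: ennreal_mult_less_top)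
  then have "energy (\<lambda>x. 1 / (2 * pi) * ?U x) < \<infinity>"
    unfolding scale[OF U] by (auto simp: ennreal_mult_less_top)
  then have "(\<lambda>x. 1 / (2 * pi) * ?U x) \<in> L2"
    unfolding L2_iff by (rule conjI[rotated]) measurable
  moreover have "((\<lambda>R. Lp_norm 2 (\<lambda>x. 1 / (2 * pi) * ?U x - 1 / (2 * pi) * (CLINT k:{-R..R}|lborel. exp (\<i> * k * x) * g k))) \<longlongrightarrow> 0) at_top"
  proof -
    have "((\<lambda>R. ennreal (1 / (2 * pi)\<^sup>2) * energy (\<lambda>x. ?U x - truncated_fourier 1 R g x)) \<longlongrightarrow> ennreal (1 / (2 * pi)\<^sup>2) * 0) at_top"
      by (intro ennreal_tendsto_cmult fourier_limit_tendsto g e s n) auto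
    then show ?thesis
      unfolding eq right_diff_distrib[symmetric]
      by (subst Lp_norm_2, measurable) (simp only: enn_powr_half_tendsto_0_iff, subst scale, auto)
  qed
  ultimately have "\<exists>h. h \<in> L2 \<and>
     ((\<lambda>R. Lp_norm 2 (\<lambda>x. h x - 1 / (2 * pi) * (CLINT k:{-R..R}|lborel. exp (\<i> * k * x) * g k))) \<longlongrightarrow> 0) at_top"
    by blast
  from someI_ex[OF this, folded inverse_fourier_L2_def]
  have mem: "inverse_fourier_L2 g \<in> L2" and lim: "((\<lambda>R. Lp_norm 2 (\<lambda>x. inverse_fourier_L2 g x - 1 / (2 * pi) * truncated_fourier 1 R g x)) \<longlongrightarrow> 0) at_top"
    unfolding eq by auto
  show "inverse_fourier_L2 g \<in> L2" by fact
  have [measurable]: "inverse_fourier_L2 g \<in> borel_measurable borel" using mem by (simp add: L2_iff)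
  \<comment> \<open>Multiplying by \<open>2 * pi\<close> removes the normalization of the inverse
    transform and brings the selected function into the form of
    \<open>fourier_limit_unique\<close>.\<close>
  define H where "H x = 2 * pi * inverse_fourier_L2 g x" for x
  have [measurable]: "H \<in> borel_measurable borel" unfolding H_def by measurable
  have H_eq: "inverse_fourier_L2 g x = 1 / (2 * pi) * H x" for x by (simp add: H_def)
  have "((\<lambda>R. energy (\<lambda>x. 1 / (2 * pi) * (H x - truncated_fourier 1 R g x))) \<longlongrightarrow> 0) at_top"
    using lim unfolding H_eq right_diff_distrib[symmetric]
    by (subst (asm) Lp_norm_2, measurable) (simp only: enn_powr_half_tendsto_0_iff)
  then have "((\<lambda>R. ennreal (1 / (2 * pi)\<^sup>2) * energy (\<lambda>x. H x - truncated_fourier 1 R g x)) \<longlongrightarrow> 0) at_top"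
    by (subst (asm) scale) auto
  then have "((\<lambda>R. ennreal ((2 * pi)\<^sup>2) * (ennreal (1 / (2 * pi)\<^sup>2) * energy (\<lambda>x. H x - truncated_fourier 1 R g x))) \<longlongrightarrow> ennreal ((2 * pi)\<^sup>2) * 0) at_top"
    by (intro ennreal_tendsto_cmult) auto
  moreover have "ennreal ((2 * pi)\<^sup>2) * (ennreal (1 / (2 * pi)\<^sup>2) * a) = a" for a
    by (subst mult.assoc[symmetric], subst ennreal_mult[symmetric]) auto
  ultimately have "((\<lambda>R. energy (\<lambda>x. H x - truncated_fourier 1 R g x)) \<longlongrightarrow> 0) at_top"
    by simp
  then have "AE x in lborel. H x = ?U x"
    by (intro fourier_limit_unique[OF g e s n]) auto
  then show "AE x in lborel. inverse_fourier_L2 g x = 1 / (2 * pi) * ?U x"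
    unfolding H_eq by eventually_elim simp
qed

section \<open>Almost everywhere equality and measurability in time of \<open>L^p\<close>
  norms\<close>

lemma eLp_norm_cong_AE:
  assumes "f \<in> borel_measurable M" "g \<in> borel_measurable M" "AE x in M. f x = g x"
  shows "eLp_norm M p f = eLp_norm M p g"
proof -
  have "esssup M f = esssup M g" using assms(3) by (rule esssup_AE_cong[OF assms(1,2)])
  moreover have "(\<integral>\<^sup>+x. enn_powr (f x) a \<partial>M) = (\<integral>\<^sup>+x. enn_powr (g x) a \<partial>M)" for a
    by (rule nn_integral_cong_AE) (use assms(3) in auto)
  ultimately show ?thesis using assms by (simp add: eLp_norm_def)
qed

text \<open>\<open>mixed_norm\<close> is infinite unless this function of \<open>t\<close> is
  measurable. For finite \<open>p\<close> it is Tonelli's theorem. For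
  \<open>p = \<infinity>\<close> a sublevel set consists of the times at which the set where
  \<open>|W t|\<close> exceeds \<open>c\<close> has measure zero, and that measure is again
  measurable in \<open>t\<close> by Tonelli.\<close>

lemma borel_measurable_Lp_norm:
  assumes [measurable]: "(\<lambda>(t, x). W t x) \<in> borel_measurable (borel \<Otimes>\<^sub>M borel)"
  shows "(\<lambda>t. Lp_norm p (W t)) \<in> borel_measurable borel"
proof (cases "p = \<infinity>")
  case False
  then have "Lp_norm p (W t) = enn_powr (\<integral>\<^sup>+x. enn_powr (ennreal (norm (W t x))) (enn2real p) \<partial>lborel) (1 / enn2real p)" for t
    by (simp add: Lp_norm_def eLp_norm_def)
  then show ?thesis by simp
next
  case True
  have eq: "Lp_norm p (W t) = esssup lborel (\<lambda>x. ennreal (norm (W t x)))" for t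
    using True by (simp add: Lp_norm_def eLp_norm_def)
  show ?thesis
  proof (rule borel_measurableI_le)
    fix c :: ennreal
    have "Lp_norm p (W t) \<le> c \<longleftrightarrow> (\<integral>\<^sup>+x. indicator {x. c < ennreal (norm (W t x))} x \<partial>lborel) = 0" for t
    proof -
      have "(\<integral>\<^sup>+x. indicator {x. c < ennreal (norm (W t x))} x \<partial>lborel) = 0 \<longleftrightarrow> (AE x in lborel. ennreal (norm (W t x)) \<le> c)"
        by (subst nn_integral_0_iff_AE) (auto simp: indicator_def not_less intro!: AE_cong)
      also have "\<dots> \<longleftrightarrow> Lp_norm p (W t) \<le> c"
      proof
        assume le: "Lp_norm p (W t) \<le> c"
        show "AE x in lborel. ennreal (norm (W t x)) \<le> c"
          using esssup_AE[of "\<lambda>x. ennreal (norm (W t x))" lborel]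
          by eventually_elim (use le in \<open>auto simp: eq intro: order_trans\<close>)
      qed (auto simp: eq)
      finally show ?thesis by simp
    qed
    then show "{t \<in> space borel. Lp_norm p (W t) \<le> c} \<in> sets borel" by simp
  qed
qed

section \<open>The Strichartz estimate\<close>

text \<open>Joint measurability is available only for \<open>W\<close>, which agrees with the chosen
  solution for almost every \<open>x\<close> at every single \<open>t\<close>. \<open>L\<close> is a
  measurable majorant of the essential supremum of \<open>|W t|^4\<close>. The factor
  \<open>28 * pi\<close> is 14 times the \<open>2 * pi\<close> lost in passing from \<open>f\<close>
  to its transform.\<close>

lemma solution_op_representation:
  fixes \<alpha> \<beta> \<gamma> \<delta> :: real and f :: "real \<Rightarrow> complex"
  assumes \<kappa>: "\<kappa> > 0" "\<forall>k>0. \<kappa> \<le> 2 * \<gamma> / k ^ 3 - 2 * \<beta> + 6 * \<delta> * k"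
    and f: "f \<in> L2"
  shows "\<exists>(W :: real \<Rightarrow> real \<Rightarrow> complex) L. (\<lambda>(t, x). W t x) \<in> borel_measurable (borel \<Otimes>\<^sub>M borel) \<and>
    L \<in> borel_measurable borel \<and>
    (\<forall>t. solution_op \<alpha> \<beta> \<gamma> \<delta> t f \<in> L2) \<and>
    (\<forall>t. AE x in lborel. solution_op \<alpha> \<beta> \<gamma> \<delta> t f x = W t x) \<and>
    (\<forall>t. energy (W t) \<le> energy f) \<and>
    (\<forall>t. AE x in lborel. ennreal (norm (W t x) ^ 4) \<le> L t) \<and>
    (\<integral>\<^sup>+t. L t * indicator {0..} t \<partial>lborel) \<le> (ennreal (28 * pi * (16 / sqrt \<kappa>)) * energy f)\<^sup>2"
proof -
  define m where "m = symbol \<alpha> \<beta> \<gamma> \<delta>"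
  have m [measurable]: "m \<in> borel_measurable borel" unfolding m_def by measurable
  define F where "F = fourier_L2 f"
  have F [measurable]: "F \<in> borel_measurable borel" and Ff: "energy F < \<infinity>"
    using fourier_L2_properties(1)[OF f] by (auto simp: F_def L2_iff)
  have FE: "energy F \<le> ennreal (2 * pi) * energy f"
    unfolding F_def by (rule fourier_L2_properties(2)[OF f])
  obtain n where n: "fast_radii F n" using fast_radii_exists[OF F Ff] by blast
  have npos: "n j > 0" for j
    using n by (auto simp: fast_radii_def intro: le_less_trans[of 0 "real j"])
  define Ft where "Ft t k = exp (- \<i> * m k * t) * F k" for t :: real and k :: real
  have Ft [measurable]: "Ft t \<in> borel_measurable borel" for t unfolding Ft_def by measurable
  have norm_Ft: "norm (Ft t k) = norm (F k)" for t k
    by (simp add: Ft_def norm_mult norm_exp_eq_Re)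
  have Ft_e: "energy (Ft t) = energy F" for t by (simp add: norm_Ft)
  have Ft_f: "energy (Ft t) < \<infinity>" for t using Ff by (simp add: norm_Ft)
  have Ft_n: "fast_radii (Ft t) n" for t using n by (simp add: fast_radii_def tail_energy_def norm_Ft)
  have s: "\<bar>1::real\<bar> = 1" by simp
  have tr: "truncated_fourier 1 R (Ft t) x = propagator m R F t x" for R t x
    by (simp add: truncated_fourier_def propagator_def Ft_def exp_diff exp_minus field_simps mult_ac)
  define U where "U t x = lim (\<lambda>j. propagator m (n j) F t x)" for t x
  have U_eq: "fourier_limit 1 n (Ft t) = U t" for t
    by (simp add: fourier_limit_def U_def tr fun_eq_iff)
  define W where "W t x = 1 / (2 * pi) * U t x" for t x
  have U_m [measurable]: "(\<lambda>(t, x). U t x) \<in> borel_measurable (borel \<Otimes>\<^sub>M borel)"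
    unfolding U_def by measurable
  have W_m: "(\<lambda>(t, x). W t x) \<in> borel_measurable (borel \<Otimes>\<^sub>M borel)"
    unfolding W_def by measurable
  have sol: "solution_op \<alpha> \<beta> \<gamma> \<delta> t f = inverse_fourier_L2 (Ft t)" for t
    by (simp add: solution_op_def Ft_def[abs_def] m_def F_def)
  have sol_L2: "solution_op \<alpha> \<beta> \<gamma> \<delta> t f \<in> L2" for t
    unfolding sol by (rule inverse_fourier_L2_properties(1)[OF Ft Ft_f Ft_n])
  have sol_AE: "AE x in lborel. solution_op \<alpha> \<beta> \<gamma> \<delta> t f x = W t x" for t
    unfolding sol W_def U_eq[symmetric] by (rule inverse_fourier_L2_properties(2)[OF Ft Ft_f Ft_n])
  \<comment> \<open>Bessel's inequality is used once for each transform; the two factors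
    \<open>2 * pi\<close> cancel the squared normalization, leaving the constant 1.\<close>
  have W_e: "energy (W t) \<le> energy f" for t
  proof -
    have "energy (W t) = ennreal (1 / (2 * pi)\<^sup>2) * energy (U t)"
      by (subst nn_integral_cmult[symmetric])
        (auto simp: W_def norm_mult norm_divide power_mult_distrib power_divide simp flip: ennreal_mult intro!: nn_integral_cong)
    also have "energy (U t) \<le> ennreal (2 * pi) * energy (Ft t)"
      unfolding U_eq[symmetric] by (rule fourier_limit_energy[OF Ft Ft_f s Ft_n])
    also have "energy (Ft t) \<le> ennreal (2 * pi) * energy f" unfolding Ft_e by (rule FE)
    finally have "energy (W t) \<le> ennreal (1 / (2 * pi)\<^sup>2) * (ennreal (2 * pi) * (ennreal (2 * pi) * energy f))"
      by (simp add: mult_left_mono)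
    also have "\<dots> = ennreal (1 / (2 * pi)\<^sup>2 * (2 * pi) * (2 * pi)) * energy f"
    proof -
      have "ennreal a * (ennreal b * (ennreal b * e)) = ennreal (a * b * b) * e" if "a \<ge> 0" "b \<ge> 0" for a b e
        using that by (simp add: ennreal_mult mult.assoc)
      then show ?thesis by simp
    qed
    also have "1 / (2 * pi)\<^sup>2 * (2 * pi) * (2 * pi) = 1" by (simp add: power2_eq_square)
    finally show ?thesis by simp
  qed
  define C where "C = 16 / sqrt \<kappa>"
  have C: "C > 0" using \<kappa> by (simp add: C_def)
  obtain P where P: "energy F = ennreal P" "P \<ge> 0" using Ff by (cases "energy F") auto
  have "\<exists>S. S \<in> borel_measurable borel \<and> (\<forall>t x. ennreal (norm (propagator m (n j) F t x) ^ 4) \<le> S t) \<and>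
    (\<integral>\<^sup>+t. S t * indicator {0..} t \<partial>lborel) \<le> ennreal ((14 * C * P)\<^sup>2)" for j
    by (rule strichartz_maximal[OF m F C _ P])
       (unfold C_def m_def, rule dispersive_kernel_bound[OF \<kappa>(1) \<kappa>(2)[rule_format] _ npos])
  then obtain S where S [measurable]: "\<And>j. S j \<in> borel_measurable borel"
    and S_le: "\<And>j t x. ennreal (norm (propagator m (n j) F t x) ^ 4) \<le> S j t"
    and S_int: "\<And>j. (\<integral>\<^sup>+t. S j t * indicator {0..} t \<partial>lborel) \<le> ennreal ((14 * C * P)\<^sup>2)"
    by metis
  \<comment> \<open>Each \<open>S j\<close> controls one truncation. The lower limit controls the
    pointwise limit of the truncations, and Fatou's lemma preserves the bound on the
    integral.\<close>
  define L where "L t = liminf (\<lambda>j. S j t)" for t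
  have L_m: "L \<in> borel_measurable borel" unfolding L_def by measurable
  have L_AE: "AE x in lborel. ennreal (norm (W t x) ^ 4) \<le> L t" for t
    using AE_fourier_limit[OF Ft[of t] Ft_f s Ft_n]
  proof eventually_elim
    fix x assume "(\<lambda>j. truncated_fourier 1 (n j) (Ft t) x) \<longlonglongrightarrow> fourier_limit 1 n (Ft t) x"
    then have "(\<lambda>j. ennreal (norm (propagator m (n j) F t x) ^ 4)) \<longlonglongrightarrow> ennreal (norm (U t x) ^ 4)"
      unfolding tr U_eq by (intro tendsto_ennrealI tendsto_intros)
    then have "ennreal (norm (U t x) ^ 4) = liminf (\<lambda>j. ennreal (norm (propagator m (n j) F t x) ^ 4))"
      by (rule lim_imp_Liminf[symmetric, rotated]) simp
    also have "\<dots> \<le> L t" unfolding L_def by (intro Liminf_mono always_eventually allI S_le)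
    finally have "ennreal (norm (U t x) ^ 4) \<le> L t" .
    \<comment> \<open>The factor \<open>1 / (2 * pi)\<close> is below 1 and is simply dropped
      here.\<close>
    moreover have "norm (W t x) ^ 4 \<le> norm (U t x) ^ 4"
    proof (rule power_mono)
      have "norm (W t x) = norm (U t x) / (2 * pi)" by (simp add: W_def norm_mult norm_divide)
      also have "\<dots> \<le> norm (U t x) / 1" using pi_gt3 by (intro divide_left_mono) auto
      finally show "norm (W t x) \<le> norm (U t x)" by simp
    qed simp
    ultimately show "ennreal (norm (W t x) ^ 4) \<le> L t" using ennreal_leI order_trans by blast
  qed
  have "(\<integral>\<^sup>+t. L t * indicator {0..} t \<partial>lborel) = (\<integral>\<^sup>+t. liminf (\<lambda>j. S j t * indicator {0..} t) \<partial>lborel)"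
    by (intro nn_integral_cong) (auto simp: L_def indicator_def Liminf_const)
  also have "\<dots> \<le> liminf (\<lambda>j. \<integral>\<^sup>+t. S j t * indicator {0..} t \<partial>lborel)"
    by (rule nn_integral_liminf) measurable
  also have "\<dots> \<le> liminf (\<lambda>j. ennreal ((14 * C * P)\<^sup>2))"
    by (intro Liminf_mono always_eventually allI S_int)
  also have "\<dots> = (ennreal (14 * C) * energy F)\<^sup>2"
    using C P by (simp add: Liminf_const ennreal_mult[symmetric] ennreal_power)
  also have "\<dots> \<le> (ennreal (14 * C) * (ennreal (2 * pi) * energy f))\<^sup>2"
    by (intro power_mono mult_left_mono FE) auto
  also have "\<dots> = (ennreal (28 * pi * C) * energy f)\<^sup>2"
    using C by (subst mult.assoc[symmetric], subst ennreal_mult[symmetric]) (auto simp: mult_ac)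
  finally have L_int: "(\<integral>\<^sup>+t. L t * indicator {0..} t \<partial>lborel) \<le> (ennreal (28 * pi * (16 / sqrt \<kappa>)) * energy f)\<^sup>2"
    unfolding C_def .
  show ?thesis
    by (intro exI[of _ W] exI[of _ L] conjI allI W_m L_m sol_L2 sol_AE W_e L_AE L_int)
qed

text \<open>With \<open>M = l powr (1/4)\<close> as bound for \<open>|w|\<close>,
  \<open>|w| powr r\<close> is at most \<open>M powr (r - 2) * |w|^2\<close>. For
  \<open>r = 2 / (1 - \<theta>)\<close> one has \<open>(r - 2) / r = \<theta>\<close>, so the power
  \<open>4 / \<theta>\<close> produces exactly \<open>M powr 4 = l\<close>. The result is linear in
  \<open>l\<close> and can be integrated in time.\<close>

lemma Lp_norm_interpolation:
  fixes w :: "real \<Rightarrow> complex" and p :: ennreal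
  assumes [measurable]: "w \<in> borel_measurable borel"
    and \<theta>: "0 < \<theta>" "\<theta> \<le> 1" and p: "p = (if \<theta> = 1 then \<infinity> else ennreal (2 / (1 - \<theta>)))"
    and B: "energy w \<le> ennreal (B\<^sup>2)" "B \<ge> 0"
    and l: "AE x in lborel. norm (w x) ^ 4 \<le> l" "l \<ge> 0"
  shows "enn_powr (Lp_norm p w) (4 / \<theta>) \<le> ennreal ((if \<theta> = 1 then 1 else B powr (4 * (1 - \<theta>) / \<theta>)) * l)"
proof -
  define M where "M = l powr (1/4)"
  have M: "M \<ge> 0" "M powr 4 = l" using l by (simp_all only: M_def powr_powr powr_ge_zero) simp
  have wM: "AE x in lborel. norm (w x) \<le> M"
    using l(1)
  proof eventually_elim
    fix x assume "norm (w x) ^ 4 \<le> l"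
    then have "(norm (w x) ^ 4) powr (1/4) \<le> M" unfolding M_def by (intro powr_mono2) auto
    moreover have "(norm (w x) ^ 4) powr (1/4) = norm (w x)"
      by (cases "w x = 0") (auto simp flip: powr_numeral simp: powr_powr)
    ultimately show "norm (w x) \<le> M" by simp
  qed
  show ?thesis
  proof (cases "\<theta> = 1")
    case True
    then have "Lp_norm p w \<le> ennreal M"
      using wM by (auto simp: p Lp_norm_def eLp_norm_def ennreal_leI elim!: eventually_mono intro!: esssup_I)
    then have "enn_powr (Lp_norm p w) 4 \<le> enn_powr (ennreal M) 4" by (intro enn_powr_mono) auto
    then show ?thesis using True M by (simp only: enn_powr_ennreal) simp
  next
    case False
    define r where "r = 2 / (1 - \<theta>)"
    have r: "r > 2" using \<theta> False by (simp add: r_def field_simps)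
    have p_r: "p = ennreal r" using False by (simp add: p r_def)
    have "(\<integral>\<^sup>+x. enn_powr (ennreal (norm (w x))) r \<partial>lborel) \<le> (\<integral>\<^sup>+x. ennreal (M powr (r - 2)) * ennreal ((norm (w x))\<^sup>2) \<partial>lborel)"
    proof (rule nn_integral_mono_AE, use wM in eventually_elim)
      fix x assume x: "norm (w x) \<le> M"
      have "norm (w x) powr r = norm (w x) powr (r - 2) * norm (w x) powr 2"
        using powr_add[of "norm (w x)" "r - 2" 2] by (simp only: diff_add_cancel)
      also have "\<dots> \<le> M powr (r - 2) * (norm (w x))\<^sup>2"
        using x r by (simp add: mult_right_mono powr_mono2)
      finally show "enn_powr (ennreal (norm (w x))) r \<le> ennreal (M powr (r - 2)) * ennreal ((norm (w x))\<^sup>2)"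
        by (simp add: enn_powr_ennreal flip: ennreal_mult)
    qed
    also have "\<dots> = ennreal (M powr (r - 2)) * energy w" by (rule nn_integral_cmult) measurable
    also have "\<dots> \<le> ennreal (M powr (r - 2)) * ennreal (B\<^sup>2)" by (intro mult_left_mono B) auto
    also have "\<dots> = ennreal (M powr (r - 2) * B\<^sup>2)" by (simp add: ennreal_mult)
    finally have "Lp_norm p w \<le> enn_powr (ennreal (M powr (r - 2) * B\<^sup>2)) (1 / r)"
      using r by (simp add: Lp_norm_def eLp_norm_def p_r enn_powr_mono)
    then have "enn_powr (Lp_norm p w) (4 / \<theta>) \<le> enn_powr (enn_powr (ennreal (M powr (r - 2) * B\<^sup>2)) (1 / r)) (4 / \<theta>)"
      using \<theta> by (intro enn_powr_mono) auto
    also have "\<dots> = ennreal ((M powr (r - 2) * B\<^sup>2) powr (1 / r * (4 / \<theta>)))"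
      by (simp add: enn_powr_ennreal powr_powr)
    also have "(M powr (r - 2) * B\<^sup>2) powr (1 / r * (4 / \<theta>)) = M powr ((r - 2) * (1 / r * (4 / \<theta>))) * B powr (2 * (1 / r * (4 / \<theta>)))"
      using B(2) by (simp add: powr_mult powr_powr flip: powr_numeral)
    also have "(r - 2) * (1 / r * (4 / \<theta>)) = 4"
      using \<theta> False by (simp add: r_def field_simps)
    also have "2 * (1 / r * (4 / \<theta>)) = 4 * (1 - \<theta>) / \<theta>"
      using \<theta> False by (simp add: r_def field_simps)
    finally show ?thesis using False M(2) by (simp add: mult.commute)
  qed
qed

theorem theorem2:
  fixes \<alpha> \<beta> \<gamma> \<delta> \<theta> :: real and p q :: ennreal
  assumes "\<alpha> \<ge> 0" and "\<gamma> > 0" and "\<delta> > 0"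
    and "\<beta> < 0 \<or> (0 < \<beta> \<and> \<beta> < 4 * \<gamma> powr (1/4) * \<delta> powr (3/4))"
    and "0 \<le> \<theta>" and "\<theta> \<le> 1"
    and "q = (if \<theta> = 0 then \<infinity> else ennreal (4 / \<theta>))"
    and "p = (if \<theta> = 1 then \<infinity> else ennreal (2 / (1 - \<theta>)))"
  shows "\<exists>C::real. C > 0 \<and>
    (\<forall>f \<in> L2. mixed_norm q p (\<lambda>t. solution_op \<alpha> \<beta> \<gamma> \<delta> t f) \<le> ennreal C * Lp_norm 2 f)"
proof -
  define \<kappa> where "\<kappa> = 8 * \<gamma> powr (1/4) * \<delta> powr (3/4) - 2 * \<beta>"
  have "0 < \<gamma> powr (1/4) * \<delta> powr (3/4)" using assms by simp
  then have \<kappa>: "\<kappa> > 0" using assms(4) by (auto simp: \<kappa>_def)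
  have \<kappa>_le: "\<forall>k>0. \<kappa> \<le> 2 * \<gamma> / k ^ 3 - 2 * \<beta> + 6 * \<delta> * k"
    unfolding \<kappa>_def using symbol_second_derivative_lower_bound assms(2,3) by blast
  define D where "D = 28 * pi * (16 / sqrt \<kappa>)"
  have D: "D > 0" using \<kappa> by (simp add: D_def)
  show ?thesis
  \<comment> \<open>Geometric interpolation of the endpoint constants: 1 at
    \<open>\<theta> = 0\<close> and \<open>D powr (1/2)\<close> at
    \<open>\<theta> = 1\<close>.\<close>
  proof (intro exI[of _ "D powr (\<theta> / 2)"] conjI ballI)
    show "D powr (\<theta> / 2) > 0" using D by simp
    fix f :: "real \<Rightarrow> complex" assume f: "f \<in> L2"
    obtain W L where W [measurable]: "(\<lambda>(t, x). W t x) \<in> borel_measurable (borel \<Otimes>\<^sub>M borel)"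
      and L [measurable]: "L \<in> borel_measurable borel"
      and WL: "(\<forall>t. solution_op \<alpha> \<beta> \<gamma> \<delta> t f \<in> L2)"
        "(\<forall>t. AE x in lborel. solution_op \<alpha> \<beta> \<gamma> \<delta> t f x = W t x)"
        "(\<forall>t. energy (W t) \<le> energy f)"
        "(\<forall>t. AE x in lborel. ennreal (norm (W t x) ^ 4) \<le> L t)"
      and Lint: "(\<integral>\<^sup>+t. L t * indicator {0..} t \<partial>lborel) \<le> (ennreal D * energy f)\<^sup>2"
      using solution_op_representation[where \<alpha>=\<alpha>, OF \<kappa> \<kappa>_le f, folded D_def]
      by (elim exE conjE) (rule that)
    note sol = WL(1,2)[rule_format] and We = WL(3)[rule_format] and WL = WL(4)[rule_format]
    have [measurable]: "W t \<in> borel_measurable borel" for t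
      using measurable_Pair2[OF W, of t] by simp
    have [measurable]: "solution_op \<alpha> \<beta> \<gamma> \<delta> t f \<in> borel_measurable borel" for t
      using sol(1) by (simp add: L2_iff)
    have f_m [measurable]: "f \<in> borel_measurable borel" and "energy f < \<infinity>" using f by (auto simp: L2_iff)
    then obtain E where E: "energy f = ennreal E" "E \<ge> 0" by (cases "energy f") auto
    define B where "B = sqrt E"
    have B: "B \<ge> 0" "energy f = ennreal (B\<^sup>2)" using E by (simp_all add: B_def)
    have Bf: "Lp_norm 2 f = ennreal B"
      using E by (simp add: Lp_norm_2 B_def enn_powr_ennreal powr_half_sqrt)
    have norm_eq: "Lp_norm p' (solution_op \<alpha> \<beta> \<gamma> \<delta> t f) = Lp_norm p' (W t)" for p' t
      unfolding Lp_norm_def by (rule eLp_norm_cong_AE) (use sol(2)[of t] in auto)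
    have [measurable]: "(\<lambda>t. Lp_norm p (W t)) \<in> borel_measurable borel"
      by (rule borel_measurable_Lp_norm[OF W])
    let ?T = "restrict_space lborel {0::real<..}"
    have meas_T: "(\<lambda>t. Lp_norm p (W t)) \<in> borel_measurable ?T"
      by (intro measurable_restrict_space1) simp
    have "mixed_norm q p (\<lambda>t. solution_op \<alpha> \<beta> \<gamma> \<delta> t f) = eLp_norm ?T q (\<lambda>t. Lp_norm p (W t))"
      unfolding mixed_norm_def norm_eq ..
    also have "\<dots> \<le> ennreal (D powr (\<theta> / 2)) * ennreal B"
    \<comment> \<open>Here \<open>q\<close> is infinite, and the energy bound at each time is
      already the claim.\<close>
    proof (cases "\<theta> = 0")
      case True
      then have pq: "p = 2" "q = \<infinity>" using assms by simp_all
      have "Lp_norm p (W t) \<le> ennreal B" for t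
        unfolding Bf[symmetric] pq using We[of t] by (simp add: Lp_norm_2 enn_powr_mono)
      then have "esssup ?T (\<lambda>t. Lp_norm p (W t)) \<le> ennreal B"
        by (intro esssup_I meas_T) auto
      then show ?thesis using meas_T pq True D by (simp add: eLp_norm_def)
    next
      case False
      then have \<theta>: "0 < \<theta>" "\<theta> \<le> 1" using assms by auto
      \<comment> \<open>At \<open>\<theta> = 1\<close> the exponent of \<open>B\<close> is 0. The
        case distinction keeps \<open>b = 1\<close> also for \<open>B = 0\<close>, where
        \<open>0 powr 0\<close> would be 0.\<close>
      define b where "b = (if \<theta> = 1 then 1 else B powr (4 * (1 - \<theta>) / \<theta>))"
      have b: "b \<ge> 0" by (simp add: b_def)
      have q: "q = ennreal (4 / \<theta>)" using False assms by simp
      have Lint': "(\<integral>\<^sup>+t. L t * indicator {0..} t \<partial>lborel) \<le> ennreal ((D * B\<^sup>2)\<^sup>2)"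
        using Lint B D by (simp add: ennreal_mult[symmetric] ennreal_power)
      then have "(\<integral>\<^sup>+t. L t * indicator {0..} t \<partial>lborel) \<noteq> \<infinity>"
        by (auto simp: top_unique)
      \<comment> \<open>\<open>Lp_norm_interpolation\<close> takes a real bound, so the null set of
        times with infinite \<open>L t\<close> is set aside.\<close>
      then have fin: "AE t in lborel. L t * indicator {0..} t \<noteq> \<infinity>"
        by (intro nn_integral_noteq_infinite) auto
      have "(\<integral>\<^sup>+t. enn_powr (Lp_norm p (W t)) (4 / \<theta>) \<partial>?T)
          = (\<integral>\<^sup>+t. enn_powr (Lp_norm p (W t)) (4 / \<theta>) * indicator {0<..} t \<partial>lborel)"
        by (rule nn_integral_restrict_space) simp
      also have "\<dots> \<le> (\<integral>\<^sup>+t. ennreal b * (L t * indicator {0..} t) \<partial>lborel)"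
      proof (rule nn_integral_mono_AE, use fin in eventually_elim)
        fix t assume t: "L t * indicator {0..} t \<noteq> \<infinity>"
        show "enn_powr (Lp_norm p (W t)) (4 / \<theta>) * indicator {0<..} t \<le> ennreal b * (L t * indicator {0..} t)"
        proof (cases "t > 0")
          case True
          then have "L t \<noteq> \<infinity>" using t by simp
          then obtain l where l: "L t = ennreal l" "l \<ge> 0" by (cases "L t") auto
          have "AE x in lborel. norm (W t x) ^ 4 \<le> l"
            using WL[of t] by eventually_elim (simp add: l)
          then have "enn_powr (Lp_norm p (W t)) (4 / \<theta>) \<le> ennreal (b * l)"
            unfolding b_def using We[of t] B l(2) \<theta> assms(8)
            by (intro Lp_norm_interpolation) auto
          then show ?thesis using True l b by (simp add: ennreal_mult)
        qed simp
      qed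
      also have "\<dots> = ennreal b * (\<integral>\<^sup>+t. L t * indicator {0..} t \<partial>lborel)"
        by (rule nn_integral_cmult) measurable
      also have "\<dots> \<le> ennreal b * ennreal ((D * B\<^sup>2)\<^sup>2)" by (intro mult_left_mono Lint') simp
      also have "\<dots> = ennreal (b * (D * B\<^sup>2)\<^sup>2)" using b by (simp add: ennreal_mult)
      finally have "eLp_norm ?T q (\<lambda>t. Lp_norm p (W t)) \<le> enn_powr (ennreal (b * (D * B\<^sup>2)\<^sup>2)) (\<theta> / 4)"
        using meas_T \<theta> by (simp add: eLp_norm_def q enn_powr_mono)
      also have "\<dots> = ennreal ((b * (D * B\<^sup>2)\<^sup>2) powr (\<theta> / 4))"
        using b by (intro enn_powr_ennreal) simp
      \<comment> \<open>The exponents of \<open>B\<close> add up to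
        \<open>(1 - \<theta>) + \<theta> = 1\<close>, as homogeneity in \<open>f\<close> demands.
        The case \<open>B = 0\<close> is separate because \<open>b\<close> depends on the
        \<open>if\<close> only there and the laws of \<open>powr\<close> are applied to positive
        bases.\<close>
      also have "(b * (D * B\<^sup>2)\<^sup>2) powr (\<theta> / 4) = D powr (\<theta> / 2) * B"
      proof (cases "B = 0")
        case True
        then show ?thesis using \<theta> by simp
      next
        case False
        then have Bp: "B > 0" using B by simp
        have "b = B powr (4 * (1 - \<theta>) / \<theta>)" using Bp by (simp add: b_def)
        then have "(b * (D * B\<^sup>2)\<^sup>2) powr (\<theta> / 4) = (B powr (4 * (1 - \<theta>) / \<theta>)) powr (\<theta> / 4) * ((D powr 2) * (B powr 4)) powr (\<theta> / 4)"
          using Bp D by (simp add: powr_mult power_mult_distrib flip: power_mult)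
        also have "(B powr (4 * (1 - \<theta>) / \<theta>)) powr (\<theta> / 4) = B powr (1 - \<theta>)"
        proof -
          have "4 * (1 - \<theta>) / \<theta> * (\<theta> / 4) = 1 - \<theta>" using \<theta> by simp
          then show ?thesis by (simp only: powr_powr)
        qed
        also have "((D powr 2) * (B powr 4)) powr (\<theta> / 4) = D powr (\<theta> / 2) * B powr \<theta>"
          using Bp D by (simp add: powr_mult powr_powr del: powr_numeral)
        also have "B powr (1 - \<theta>) * (D powr (\<theta> / 2) * B powr \<theta>) = D powr (\<theta> / 2) * B powr ((1 - \<theta>) + \<theta>)"
          by (simp only: powr_add mult_ac)
        finally show ?thesis using Bp by simp
      qed
      finally show ?thesis using D B by (simp add: ennreal_mult)
    qed
    finally show "mixed_norm q p (\<lambda>t. solution_op \<alpha> \<beta> \<gamma> \<delta> t f) \<le> ennreal (D powr (\<theta> / 2)) * Lp_norm 2 f"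
      unfolding Bf .
  qed
qed

end
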